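(* Let $n \ge 6$ and $U_f : \mathbb{Z}_3^n \to \{A,B,C,X,Y,Z\}$. If $U_f$ has induced degree $1$ and $U_f(0^n) = X$, then there exists $I \subseteq [n]$ with $|I| \ge n-4$ such that the restriction of $U_f$ to $H = \{x \in \mathbb{Z}_3^n : x_i = 0 \text{ for all } i \notin I\}$ is canonical.
   Context: $A = \{0\}$, $B = \{1\}$, $C = \{2\}$, $X = \{1,2\}$, $Y = \{0,2\}$, $Z = \{0,1\}$. A function $U_f : \mathbb{Z}_3^n \to \{A,B,C,X,Y,Z\}$ corresponds to the set $U = \bigcup_{x \in \mathbb{Z}_3^n} U_f(x) \times \{x\} \subseteq \mathbb{Z}_3^{n+1}$ (first coordinate from $U_f(x)$). $H(m,3)$ is the Hamming graph on $\mathbb{Z}_3^m$ (vertices adjacent iff they differ in exactly one coordinate). $U_f$ has induced degree $1$ if the subgraph of $H(n+1,3)$ induced by $U$ has maximum degree $1$. A set $V \subseteq \mathbb{Z}_3^m$ is canonical if $|V| \ge 3^{m-1}+1$, $V$ is disjoint from some maximum size independent set of $H(m,3)$, and $V$ induces a subgraph of maximum degree at most $1$. $0^n$ is the zero vector. The restriction of $U_f$ to $H$ is canonical if $U \cap (\mathbb{Z}_3 \times H)$, viewed as a subset of $\mathbb{Z}_3^{|I|+1}$ via the first coordinate and the coordinates in $I$, is canonical. *)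

theory Defs
  imports Complex_Main "HOL-Library.FuncSet" "HOL-Library.Numeral_Type"
begin

text \<open>
  The type \<open>3\<close> of \<^theory>\<open>HOL-Library.Numeral_Type\<close> is the ring of integers modulo 3.
  Vectors are indexed by an arbitrary finite set \<open>J\<close> of coordinates and are extensional outside
  \<open>J\<close>, so that \<open>Z3_vecs J\<close> is a copy of $\mathbb{Z}_3^{|J|}$.
\<close>

definition Z3_vecs :: "nat set \<Rightarrow> (nat \<Rightarrow> 3) set" where
  "Z3_vecs J = J \<rightarrow>\<^sub>E UNIV"

definition hamming_adj :: "nat set \<Rightarrow> (nat \<Rightarrow> 3) \<Rightarrow> (nat \<Rightarrow> 3) \<Rightarrow> bool" where
  "hamming_adj J x y \<longleftrightarrow> x \<in> Z3_vecs J \<and> y \<in> Z3_vecs J \<and> card {i \<in> J. x i \<noteq> y i} = 1"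

text \<open>The supremum of the empty set of naturals is 0, so the empty graph has maximum degree 0.\<close>

definition induced_max_degree :: "('v \<Rightarrow> 'v \<Rightarrow> bool) \<Rightarrow> 'v set \<Rightarrow> nat" where
  "induced_max_degree adj V = (SUP v\<in>V. card {w \<in> V. adj v w})"

definition hamming_independent :: "nat set \<Rightarrow> (nat \<Rightarrow> 3) set \<Rightarrow> bool" where
  "hamming_independent J S \<longleftrightarrow>
     S \<subseteq> Z3_vecs J \<and> (\<forall>x\<in>S. \<forall>y\<in>S. \<not> hamming_adj J x y)"

definition hamming_max_independent :: "nat set \<Rightarrow> (nat \<Rightarrow> 3) set \<Rightarrow> bool" where
  "hamming_max_independent J S \<longleftrightarrow>
     hamming_independent J S \<and> (\<forall>T. hamming_independent J T \<longrightarrow> card T \<le> card S)"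

definition canonical :: "nat set \<Rightarrow> (nat \<Rightarrow> 3) set \<Rightarrow> bool" where
  "canonical J V \<longleftrightarrow>
     V \<subseteq> Z3_vecs J \<and>
     card V \<ge> 3 ^ (card J - 1) + 1 \<and>
     (\<exists>S. hamming_max_independent J S \<and> V \<inter> S = {}) \<and>
     induced_max_degree (hamming_adj J) V \<le> 1"

definition val_A :: "3 set" where "val_A = {0}"
definition val_B :: "3 set" where "val_B = {1}"
definition val_C :: "3 set" where "val_C = {2}"
definition val_X :: "3 set" where "val_X = {1, 2}"
definition val_Y :: "3 set" where "val_Y = {0, 2}"
definition val_Z :: "3 set" where "val_Z = {0, 1}"

text \<open>
  The coordinates of $\mathbb{Z}_3^n$ are \<open>{1..n}\<close>; the additional first coordinate of
  $\mathbb{Z}_3^{n+1}$ has index 0. Thus \<open>x(0 := c)\<close> is the vector \<open>(c, x)\<close>, and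
  \<open>fibred D F\<close> is the union of the sets \<open>F x \<times> {x}\<close> over \<open>x \<in> D\<close>.
\<close>

definition fibred :: "(nat \<Rightarrow> 3) set \<Rightarrow> ((nat \<Rightarrow> 3) \<Rightarrow> 3 set) \<Rightarrow> (nat \<Rightarrow> 3) set" where
  "fibred D F = (\<Union>x\<in>D. (\<lambda>c. x(0 := c)) ` F x)"

definition corresponding_set :: "nat \<Rightarrow> ((nat \<Rightarrow> 3) \<Rightarrow> 3 set) \<Rightarrow> (nat \<Rightarrow> 3) set" where
  "corresponding_set n Uf = fibred (Z3_vecs {1..n}) Uf"

definition has_induced_degree_1 :: "nat \<Rightarrow> ((nat \<Rightarrow> 3) \<Rightarrow> 3 set) \<Rightarrow> bool" where
  "has_induced_degree_1 n Uf \<longleftrightarrow>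
     induced_max_degree (hamming_adj {0..n}) (corresponding_set n Uf) = 1"

definition zero_vec :: "nat \<Rightarrow> nat \<Rightarrow> 3" where
  "zero_vec n = (\<lambda>i\<in>{1..n}. 0)"

definition coord_subcube :: "nat \<Rightarrow> nat set \<Rightarrow> (nat \<Rightarrow> 3) set" where
  "coord_subcube n I = {x \<in> Z3_vecs {1..n}. \<forall>i\<in>{1..n} - I. x i = 0}"

definition restriction_canonical :: "nat \<Rightarrow> ((nat \<Rightarrow> 3) \<Rightarrow> 3 set) \<Rightarrow> nat set \<Rightarrow> bool" where
  "restriction_canonical n Uf I \<longleftrightarrow>
     canonical (insert 0 I)
       ((\<lambda>u. restrict u (insert 0 I)) `
          (corresponding_set n Uf \<inter> fibred (coord_subcube n I) (\<lambda>_. UNIV)))"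

end

theory Submission
  imports Defs
begin

text \<open>
  Write \<open>f(x)\<close> for the fibre of the set over \<open>x\<close>. Since \<open>f(0) = {1, 2}\<close>, all points of weight 1 have
  fibre \<open>{0}\<close>, and they are matched in pairs, so that every point of weight 2 has fibre \<open>{1}\<close> or
  \<open>{2}\<close>. On the four points of weight 2 supported on a pair \<open>i, j\<close>, which form a 4-cycle, \<open>f\<close> is
  therefore \<open>e a b\<close> (\<open>i\<close> and \<open>j\<close> alternate), \<open>s a\<close> (\<open>i\<close> is directed to \<open>j\<close>) or \<open>s b\<close> (\<open>j\<close> is
  directed to \<open>i\<close>), with signs \<open>e, s\<close>.

  If no pair alternates, then the directions form a transitive tournament with one sign for each
  source, and by induction on the weight the value at a point is the signed sum of its coordinates
  except the last one. So \<open>f\<close> avoids the linear form given by all coordinates, whose graph is a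
  maximum independent set. It remains to meet all alternating pairs with four coordinates.

  Points of weight 3 and 4 show that, as induced subgraphs on four vertices, the graph of
  alternating pairs contains neither two disjoint edges nor a path, claw, paw or square. Its edges
  then lie in a maximum clique together with at most one further vertex, which misses just one
  vertex of the clique, so it remains to exclude cliques of size 6. In a clique, each triple has a
  sign, the product of the signs of its pairs. Each triple forces some points of weight 2 to be
  matched in the third direction. Two triples of the same sign sharing a pair cannot use the same
  point, and this rules out four triples of the same sign on four vertices. On six vertices it
  yields, for the edges among five vertices seen from the sixth, a proper edge colouring of
  \<open>K\<^sub>5\<close> by four colours (the sign of the triple and the matched point), which does not exist.
\<close>

section \<open>Arithmetic modulo 3\<close>

lemma exhaust_Z3:
  fixes x :: 3
  shows "x = 0 \<or> x = 1 \<or> x = 2"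
proof (induct x)
  case (of_int z)
  then have "z = 0 \<or> z = 1 \<or> z = 2" by fastforce
  then show ?case by auto
qed

lemma nonzero_Z3: "(x::3) \<noteq> 0 \<longleftrightarrow> x = 1 \<or> x = 2"
  using exhaust_Z3[of x] by auto

lemma numerals_Z3 [simp]: "(3::3) = 0" "(4::3) = 1"
  by simp_all

lemma mult_eq_0_Z3 [simp]: "(x::3) * y = 0 \<longleftrightarrow> x = 0 \<or> y = 0"
  using exhaust_Z3[of x] exhaust_Z3[of y] by auto

lemma square_Z3: "(x::3) \<noteq> 0 \<Longrightarrow> x * x = 1"
  using exhaust_Z3[of x] by auto

lemma square_left_Z3: "(x::3) \<noteq> 0 \<Longrightarrow> x * (x * y) = y"
  by (simp add: square_Z3 flip: mult.assoc)

lemma mult_left_cancel_Z3: "(x::3) \<noteq> 0 \<Longrightarrow> x * y = x * z \<longleftrightarrow> y = z"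
  by (metis square_left_Z3)

lemma double_eq_Z3 [simp]: "2 * (x::3) = x \<longleftrightarrow> x = 0" "x = 2 * x \<longleftrightarrow> x = 0"
  using exhaust_Z3[of x] by auto

lemma eq_0_Z3: "\<lbrakk>a \<noteq> 0; b \<noteq> 0; a \<noteq> b; c \<noteq> a; c \<noteq> b\<rbrakk> \<Longrightarrow> (c::3) = 0"
  using exhaust_Z3[of a] exhaust_Z3[of b] exhaust_Z3[of c] by auto

lemma mult_eq_iff_Z3: "(s::3) \<noteq> 0 \<Longrightarrow> s * c = x \<longleftrightarrow> c = s * x"
  by (metis square_left_Z3)

lemma mult_eq_iff_right_Z3: "(s::3) \<noteq> 0 \<Longrightarrow> c * s = x \<longleftrightarrow> c = x * s"
  by (metis mult_eq_iff_Z3 mult.commute)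

lemmas Z3_simps = square_Z3 square_left_Z3 mult_eq_iff_Z3 mult_eq_iff_right_Z3 ac_simps

section \<open>Subsets of induced degree 1 in low dimension\<close>

text \<open>Adjacency in a Hamming graph, as a recursion that the simplifier decides on explicit
  lists.\<close>

fun adjl :: "'a list \<Rightarrow> 'a list \<Rightarrow> bool" where
  "adjl (x # xs) (y # ys) = (if x = y then adjl xs ys else xs = ys)"
| "adjl _ _ = False"

text \<open>
  \<open>P\<close> is the membership predicate of a subset of $\mathbb{Z}_3^{m+1}$ meeting each line in the first
  direction: the head of a list is the element of the fibre over the tail.
\<close>

locale grid =
  fixes m :: nat and P :: "3 list \<Rightarrow> bool"
  assumes deg: "\<lbrakk>length p = Suc m; P p; P q; P r; adjl p q; adjl p r\<rbrakk> \<Longrightarrow> q = r"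
    and fibre: "length vs = m \<Longrightarrow> \<exists>c. P (c # vs)"
begin

text \<open>Two uses of the degree bound: once \<open>p\<close> has the neighbour \<open>q\<close>,
  its other neighbours lie outside the set; and, in the next lemma, a point with two neighbours in
  the set lies outside itself.\<close>

lemma exclude_side:
  "\<lbrakk>P p; P q; adjl p q; adjl p r; q \<noteq> r; length p = Suc m\<rbrakk> \<Longrightarrow> \<not> P r"
  by (metis deg)

lemma exclude_mid:
  "\<lbrakk>P q; P r; adjl p q; adjl p r; q \<noteq> r; length p = Suc m\<rbrakk> \<Longrightarrow> \<not> P p"
  by (metis deg)

lemma only_left:
  "\<lbrakk>\<not> P (a # vs); \<not> P (b # vs); a \<noteq> b; c \<noteq> a; c \<noteq> b; length vs = m\<rbrakk> \<Longrightarrow> P (c # vs)"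
proof -
  assume a: "\<not> P (a # vs)" "\<not> P (b # vs)" "a \<noteq> b" "c \<noteq> a" "c \<noteq> b" "length vs = m"
  then obtain d where "P (d # vs)" using fibre by blast
  moreover from this a have "d = c"
    using exhaust_Z3[of a] exhaust_Z3[of b] exhaust_Z3[of c] exhaust_Z3[of d] by auto
  ultimately show ?thesis by simp
qed

text \<open>The elements 1 and 2 over the origin are matched to each other, which forces 0 at weight
  1 and rules out 0 at weight 2. The fibres at weight 2 then label a 4-cycle by 1 and 2 such that no
  vertex agrees with both neighbours: the labels alternate, or they are constant on two opposite
  edges.\<close>

lemma weight2_cases:
  assumes m: "m = 2"
    and zero: "\<not> P [0, 0, 0]" "P [1, 0, 0]" "P [2, 0, 0]"
  obtains s where "s \<noteq> 0" "\<And>a b c. \<lbrakk>a \<noteq> 0; b \<noteq> 0\<rbrakk> \<Longrightarrow> P [c, a, b] \<longleftrightarrow> c = s * a * b"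
  | s where "s \<noteq> 0" "\<And>a b c. \<lbrakk>a \<noteq> 0; b \<noteq> 0\<rbrakk> \<Longrightarrow> P [c, a, b] \<longleftrightarrow> c = s * a"
  | s where "s \<noteq> 0" "\<And>a b c. \<lbrakk>a \<noteq> 0; b \<noteq> 0\<rbrakk> \<Longrightarrow> P [c, a, b] \<longleftrightarrow> c = s * b"
proof -
  note [simp] = m zero
  have l [simp]: "P [0, a, 0]" if "a \<noteq> 0" for a
  proof -
    have "\<not> P [1, a, 0]"
      by (rule exclude_side[of "[1, 0, 0]" "[2, 0, 0]"]) (use that in simp_all)
    moreover have "\<not> P [2, a, 0]"
      by (rule exclude_side[of "[2, 0, 0]" "[1, 0, 0]"]) (use that in simp_all)
    ultimately show ?thesis by (rule only_left) simp_all
  qed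
  have n0: "\<not> P [0, a, b]" if "a \<noteq> 0" "b \<noteq> 0" for a b
    by (rule exclude_side[of "[0, a, 0]" "[0, 2 * a, 0]"]) (use that in simp_all)
  have n12: "P [1, a, b] \<longleftrightarrow> \<not> P [2, a, b]" if ab: "a \<noteq> 0" "b \<noteq> 0" for a b
  proof
    assume 2: "P [1, a, b]"
    show "\<not> P [2, a, b]"
    proof
      assume 3: "P [2, a, b]"
      \<comment> \<open>If 1 and 2 both lay over \<open>(a, b)\<close>, they would be matched to
        each other, leaving only 0 over the neighbour \<open>(2 * a, b)\<close>.\<close>
      have "\<not> P [1, 2 * a, b]"
        by (rule exclude_side[of "[1, a, b]" "[2, a, b]"]) (use ab 2 3 in simp_all)
      moreover have "\<not> P [2, 2 * a, b]"
        by (rule exclude_side[of "[2, a, b]" "[1, a, b]"]) (use ab 2 3 in simp_all)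
      ultimately have "P [0, 2 * a, b]" by (rule only_left) simp_all
      then show False using n0 ab by simp
    qed
  qed (use n0[OF ab] only_left[of 0 "[a, b]" 2 1] in simp)
  have d: "P [c, a, b] \<Longrightarrow> P [c, 2 * a, b] \<Longrightarrow> \<not> P [c, a, 2 * b]" if "a \<noteq> 0" "b \<noteq> 0" for a b c
    by (rule exclude_side[of "[c, a, b]" "[c, 2 * a, b]"]) (use that in simp_all)
  define \<phi> where "\<phi> a b = (if P [1, a, b] then 1 else 2 :: 3)" for a b
  have \<phi>: "P [c, a, b] \<longleftrightarrow> c = \<phi> a b" if "a \<noteq> 0" "b \<noteq> 0" for a b c
    using n12[OF that] n0[OF that] exhaust_Z3[of c] by (auto simp: \<phi>_def)
  have \<phi>d: "\<not> (\<phi> a b = \<phi> (2 * a) b \<and> \<phi> a b = \<phi> a (2 * b))" if "a \<noteq> 0" "b \<noteq> 0" for a b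
    using d[OF that, of "\<phi> a b"] that by (simp add: \<phi>)
  have \<phi>0: "\<phi> a b = 1 \<or> \<phi> a b = 2" for a b by (simp add: \<phi>_def)
  define p q r s where pqrs: "p = \<phi> 1 1" "q = \<phi> 1 2" "r = \<phi> 2 1" "s = \<phi> 2 2"
  have "p = 1 \<or> p = 2" "q = 1 \<or> q = 2" "r = 1 \<or> r = 2" "s = 1 \<or> s = 2"
    unfolding pqrs by (rule \<phi>0)+
  moreover have "\<not> (p = r \<and> p = q)" "\<not> (q = s \<and> q = p)" "\<not> (r = p \<and> r = s)" "\<not> (s = q \<and> s = r)"
    using \<phi>d[of 1 1] \<phi>d[of 1 2] \<phi>d[of 2 1] \<phi>d[of 2 2] unfolding pqrs by simp_all
  ultimately have "q = 2 * p \<and> r = 2 * p \<and> s = p \<or> q = p \<and> r = 2 * p \<and> s = 2 * p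
      \<or> q = 2 * p \<and> r = p \<and> s = 2 * p"
    by (elim disjE; simp)
  then consider "\<phi> 1 2 = 2 * \<phi> 1 1" "\<phi> 2 1 = 2 * \<phi> 1 1" "\<phi> 2 2 = \<phi> 1 1"
    | "\<phi> 1 2 = \<phi> 1 1" "\<phi> 2 1 = 2 * \<phi> 1 1" "\<phi> 2 2 = 2 * \<phi> 1 1"
    | "\<phi> 1 2 = 2 * \<phi> 1 1" "\<phi> 2 1 = \<phi> 1 1" "\<phi> 2 2 = 2 * \<phi> 1 1"
    unfolding pqrs by blast
  then show thesis
  proof cases
    case 1
    show thesis by (rule that(1)[of "\<phi> 1 1"]) (use 1 \<phi>0[of 1 1] in \<open>auto simp: \<phi> nonzero_Z3\<close>)
  next
    case 2
    show thesis by (rule that(2)[of "\<phi> 1 1"]) (use 2 \<phi>0[of 1 1] in \<open>auto simp: \<phi> nonzero_Z3\<close>)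
  next
    case 3
    show thesis by (rule that(3)[of "\<phi> 1 1"]) (use 3 \<phi>0[of 1 1] in \<open>auto simp: \<phi> nonzero_Z3\<close>)
  qed
qed

text \<open>
  In the next lemmas the values at weight 2 are prescribed with all possible signs normalised to 1
  (see \<open>rescaled\<close> below). The proofs then need no case distinctions: an element shared by two adjacent
  fibres is excluded from all their other neighbours, and a fibre from which two elements are
  excluded consists of the third.
\<close>

lemma sources_same_sign:
  assumes [simp]: "m = 3"
    and [simp]: "\<And>a b c. \<lbrakk>a \<noteq> 0; b \<noteq> 0\<rbrakk> \<Longrightarrow> P [c, a, b, 0] \<longleftrightarrow> c = a"
    and [simp]: "\<And>a b c. \<lbrakk>a \<noteq> 0; b \<noteq> 0\<rbrakk> \<Longrightarrow> P [c, a, 0, b] \<longleftrightarrow> c = 2 * a"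
  shows False
proof -
  have [simp]: "\<not> P [1, 1, 1, 1]" by (rule exclude_side[of "[1, 1, 1, 0]" "[1, 1, 2, 0]"]) simp_all
  have [simp]: "\<not> P [2, 1, 1, 1]" by (rule exclude_side[of "[2, 1, 0, 1]" "[2, 1, 0, 2]"]) simp_all
  have [simp]: "P [0, 1, 1, 1]" by (rule only_left[of 1 _ 2]) simp_all
  have [simp]: "\<not> P [1, 2, 1, 1]" by (rule exclude_side[of "[1, 2, 0, 1]" "[1, 2, 0, 2]"]) simp_all
  have [simp]: "\<not> P [2, 2, 1, 1]" by (rule exclude_side[of "[2, 2, 1, 0]" "[2, 2, 2, 0]"]) simp_all
  have [simp]: "P [0, 2, 1, 1]" by (rule only_left[of 1 _ 2]) simp_all
  have [simp]: "\<not> P [1, 1, 2, 1]" by (rule exclude_side[of "[1, 1, 2, 0]" "[1, 1, 1, 0]"]) simp_all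
  have [simp]: "\<not> P [2, 1, 2, 1]" by (rule exclude_side[of "[2, 1, 0, 1]" "[2, 1, 0, 2]"]) simp_all
  have [simp]: "P [0, 1, 2, 1]" by (rule only_left[of 1 _ 2]) simp_all
  \<comment> \<open>The element 0 over (1, 1, 1) has two neighbours. The next lemma ends in the same
    way at (1, 1, 2).\<close>
  have "\<not> P [0, 1, 2, 1]" by (rule exclude_side[of "[0, 1, 1, 1]" "[0, 2, 1, 1]"]) simp_all
  then show False by simp
qed

lemma directed_cycle:
  assumes [simp]: "m = 3"
    and [simp]: "\<And>a b c. \<lbrakk>a \<noteq> 0; b \<noteq> 0\<rbrakk> \<Longrightarrow> P [c, a, b, 0] \<longleftrightarrow> c = a"
    and [simp]: "\<And>a b c. \<lbrakk>a \<noteq> 0; b \<noteq> 0\<rbrakk> \<Longrightarrow> P [c, 0, a, b] \<longleftrightarrow> c = a"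
    and [simp]: "\<And>a b c. \<lbrakk>a \<noteq> 0; b \<noteq> 0\<rbrakk> \<Longrightarrow> P [c, a, 0, b] \<longleftrightarrow> c = b"
  shows False
proof -
  have [simp]: "\<not> P [1, 1, 1, 2]" by (rule exclude_side[of "[1, 1, 1, 0]" "[1, 1, 2, 0]"]) simp_all
  have [simp]: "\<not> P [2, 1, 1, 2]" by (rule exclude_side[of "[2, 1, 0, 2]" "[2, 2, 0, 2]"]) simp_all
  have [simp]: "P [0, 1, 1, 2]" by (rule only_left[of 1 _ 2]) simp_all
  have [simp]: "\<not> P [1, 2, 1, 2]" by (rule exclude_side[of "[1, 0, 1, 2]" "[1, 0, 1, 1]"]) simp_all
  have [simp]: "\<not> P [2, 2, 1, 2]" by (rule exclude_side[of "[2, 2, 1, 0]" "[2, 2, 2, 0]"]) simp_all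
  have [simp]: "P [0, 2, 1, 2]" by (rule only_left[of 1 _ 2]) simp_all
  have [simp]: "\<not> P [1, 1, 2, 2]" by (rule exclude_side[of "[1, 1, 2, 0]" "[1, 1, 1, 0]"]) simp_all
  have [simp]: "\<not> P [2, 1, 2, 2]" by (rule exclude_side[of "[2, 0, 2, 2]" "[2, 0, 2, 1]"]) simp_all
  have [simp]: "P [0, 1, 2, 2]" by (rule only_left[of 1 _ 2]) simp_all
  have "\<not> P [0, 1, 2, 2]" by (rule exclude_side[of "[0, 1, 1, 2]" "[0, 2, 1, 2]"]) simp_all
  then show False by simp
qed

text \<open>The element 0 is shared by (1, 2, 1) and (1, 2, 2), which leaves 1 over (2, 2, 1) and
  (2, 2, 2). As 1 also lies over (2, 2, 0), a whole line is in the set. With the opposite sign, the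
  line through (1, 1, 0) is filled by 2 instead.\<close>

lemma alternating_to_sink_pos:
  assumes [simp]: "m = 3"
    and [simp]: "\<And>a b c. \<lbrakk>a \<noteq> 0; b \<noteq> 0\<rbrakk> \<Longrightarrow> P [c, a, b, 0] \<longleftrightarrow> c = a * b"
    and [simp]: "\<And>a b c. \<lbrakk>a \<noteq> 0; b \<noteq> 0\<rbrakk> \<Longrightarrow> P [c, a, 0, b] \<longleftrightarrow> c = a"
    and [simp]: "\<And>a b c. \<lbrakk>a \<noteq> 0; b \<noteq> 0\<rbrakk> \<Longrightarrow> P [c, 0, a, b] \<longleftrightarrow> c = a"
  shows False
proof -
  have [simp]: "\<not> P [1, 1, 2, 1]" by (rule exclude_side[of "[1, 1, 0, 1]" "[1, 1, 0, 2]"]) simp_all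
  have [simp]: "\<not> P [2, 1, 2, 1]" by (rule exclude_mid[of "[2, 1, 2, 0]" "[2, 0, 2, 1]"]) simp_all
  have [simp]: "P [0, 1, 2, 1]" by (rule only_left[of 1 _ 2]) simp_all
  have [simp]: "\<not> P [1, 1, 2, 2]" by (rule exclude_side[of "[1, 1, 0, 2]" "[1, 1, 0, 1]"]) simp_all
  have [simp]: "\<not> P [2, 1, 2, 2]" by (rule exclude_mid[of "[2, 1, 2, 0]" "[2, 0, 2, 2]"]) simp_all
  have [simp]: "P [0, 1, 2, 2]" by (rule only_left[of 1 _ 2]) simp_all
  have [simp]: "\<not> P [0, 2, 2, 1]" by (rule exclude_side[of "[0, 1, 2, 1]" "[0, 1, 2, 2]"]) simp_all
  have [simp]: "\<not> P [2, 2, 2, 1]" by (rule exclude_side[of "[2, 2, 0, 1]" "[2, 2, 0, 2]"]) simp_all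
  have [simp]: "P [1, 2, 2, 1]" by (rule only_left[of 0 _ 2]) simp_all
  have [simp]: "\<not> P [0, 2, 2, 2]" by (rule exclude_side[of "[0, 1, 2, 2]" "[0, 1, 2, 1]"]) simp_all
  have [simp]: "\<not> P [2, 2, 2, 2]" by (rule exclude_side[of "[2, 2, 0, 2]" "[2, 2, 0, 1]"]) simp_all
  have [simp]: "P [1, 2, 2, 2]" by (rule only_left[of 0 _ 2]) simp_all
  have "\<not> P [1, 2, 2, 2]" by (rule exclude_side[of "[1, 2, 2, 1]" "[1, 2, 2, 0]"]) simp_all
  then show False by simp
qed

lemma alternating_to_sink_neg:
  assumes [simp]: "m = 3"
    and [simp]: "\<And>a b c. \<lbrakk>a \<noteq> 0; b \<noteq> 0\<rbrakk> \<Longrightarrow> P [c, a, b, 0] \<longleftrightarrow> c = 2 * a * b"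
    and [simp]: "\<And>a b c. \<lbrakk>a \<noteq> 0; b \<noteq> 0\<rbrakk> \<Longrightarrow> P [c, a, 0, b] \<longleftrightarrow> c = a"
    and [simp]: "\<And>a b c. \<lbrakk>a \<noteq> 0; b \<noteq> 0\<rbrakk> \<Longrightarrow> P [c, 0, a, b] \<longleftrightarrow> c = a"
  shows False
proof -
  have [simp]: "\<not> P [1, 1, 2, 1]" by (rule exclude_mid[of "[1, 1, 2, 0]" "[1, 1, 0, 1]"]) simp_all
  have [simp]: "\<not> P [2, 1, 2, 1]" by (rule exclude_side[of "[2, 0, 2, 1]" "[2, 0, 2, 2]"]) simp_all
  have [simp]: "P [0, 1, 2, 1]" by (rule only_left[of 1 _ 2]) simp_all
  have [simp]: "\<not> P [1, 1, 2, 2]" by (rule exclude_mid[of "[1, 1, 2, 0]" "[1, 1, 0, 2]"]) simp_all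
  have [simp]: "\<not> P [2, 1, 2, 2]" by (rule exclude_side[of "[2, 0, 2, 2]" "[2, 0, 2, 1]"]) simp_all
  have [simp]: "P [0, 1, 2, 2]" by (rule only_left[of 1 _ 2]) simp_all
  have [simp]: "\<not> P [0, 1, 1, 1]" by (rule exclude_side[of "[0, 1, 2, 1]" "[0, 1, 2, 2]"]) simp_all
  have [simp]: "\<not> P [1, 1, 1, 1]" by (rule exclude_side[of "[1, 1, 0, 1]" "[1, 1, 0, 2]"]) simp_all
  have [simp]: "P [2, 1, 1, 1]" by (rule only_left[of 0 _ 1]) simp_all
  have [simp]: "\<not> P [0, 1, 1, 2]" by (rule exclude_side[of "[0, 1, 2, 2]" "[0, 1, 2, 1]"]) simp_all
  have [simp]: "\<not> P [1, 1, 1, 2]" by (rule exclude_side[of "[1, 1, 0, 2]" "[1, 1, 0, 1]"]) simp_all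
  have [simp]: "P [2, 1, 1, 2]" by (rule only_left[of 0 _ 1]) simp_all
  have "\<not> P [2, 1, 1, 2]" by (rule exclude_side[of "[2, 1, 1, 1]" "[2, 1, 1, 0]"]) simp_all
  then show False by simp
qed

lemma alternating_path_through:
  assumes [simp]: "m = 3"
    and [simp]: "\<And>a b c. \<lbrakk>a \<noteq> 0; b \<noteq> 0\<rbrakk> \<Longrightarrow> P [c, a, b, 0] \<longleftrightarrow> c = a * b"
    and [simp]: "\<And>a b c. \<lbrakk>a \<noteq> 0; b \<noteq> 0\<rbrakk> \<Longrightarrow> P [c, a, 0, b] \<longleftrightarrow> c = a"
    and [simp]: "\<And>a b c. \<lbrakk>a \<noteq> 0; b \<noteq> 0\<rbrakk> \<Longrightarrow> P [c, 0, a, b] \<longleftrightarrow> c = b"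
  shows False
proof -
  have [simp]: "\<not> P [1, 1, 2, 2]" by (rule exclude_side[of "[1, 1, 0, 2]" "[1, 1, 0, 1]"]) simp_all
  have [simp]: "\<not> P [2, 1, 2, 2]" by (rule exclude_mid[of "[2, 1, 2, 0]" "[2, 0, 2, 2]"]) simp_all
  have [simp]: "P [0, 1, 2, 2]" by (rule only_left[of 1 _ 2]) simp_all
  have [simp]: "\<not> P [1, 1, 1, 2]" by (rule exclude_mid[of "[1, 1, 1, 0]" "[1, 1, 0, 2]"]) simp_all
  have [simp]: "\<not> P [2, 1, 1, 2]" by (rule exclude_side[of "[2, 0, 1, 2]" "[2, 0, 2, 2]"]) simp_all
  have [simp]: "P [0, 1, 1, 2]" by (rule only_left[of 1 _ 2]) simp_all
  have [simp]: "\<not> P [0, 2, 2, 2]" by (rule exclude_side[of "[0, 1, 2, 2]" "[0, 1, 1, 2]"]) simp_all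
  have [simp]: "\<not> P [2, 2, 2, 2]" by (rule exclude_side[of "[2, 2, 0, 2]" "[2, 2, 0, 1]"]) simp_all
  have [simp]: "P [1, 2, 2, 2]" by (rule only_left[of 0 _ 2]) simp_all
  have [simp]: "\<not> P [0, 2, 1, 2]" by (rule exclude_side[of "[0, 1, 1, 2]" "[0, 1, 2, 2]"]) simp_all
  have [simp]: "\<not> P [2, 2, 1, 2]" by (rule exclude_mid[of "[2, 2, 1, 0]" "[2, 0, 1, 2]"]) simp_all
  have [simp]: "P [1, 2, 1, 2]" by (rule only_left[of 0 _ 2]) simp_all
  have "\<not> P [1, 2, 2, 0]" by (rule exclude_side[of "[1, 2, 2, 2]" "[1, 2, 1, 2]"]) simp_all
  then show False by simp
qed

text \<open>First 0 is forced over (2, 1, 1) and (2, 2, 2). Their common neighbours (2, 1, 2) and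
  (2, 2, 1) cannot have 0 and are left with the values of (2, 1, 0) and (2, 2, 0), to which they are
  matched.\<close>

lemma cherry_exceptional:
  assumes [simp]: "m = 3"
    and [simp]: "\<And>a b c. \<lbrakk>a \<noteq> 0; b \<noteq> 0\<rbrakk> \<Longrightarrow> P [c, a, b, 0] \<longleftrightarrow> c = a * b"
    and [simp]: "\<And>a b c. \<lbrakk>a \<noteq> 0; b \<noteq> 0\<rbrakk> \<Longrightarrow> P [c, a, 0, b] \<longleftrightarrow> c = a * b"
    and [simp]: "\<And>a b c. \<lbrakk>a \<noteq> 0; b \<noteq> 0\<rbrakk> \<Longrightarrow> P [c, 0, a, b] \<longleftrightarrow> c = a"
  shows "P [2, 2, 1, 2]" "P [1, 2, 2, 1]"
proof -
  have [simp]: "\<not> P [1, 2, 1, 1]" by (rule exclude_side[of "[1, 0, 1, 1]" "[1, 0, 1, 2]"]) simp_all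
  have [simp]: "\<not> P [2, 2, 1, 1]" by (rule exclude_mid[of "[2, 2, 1, 0]" "[2, 2, 0, 1]"]) simp_all
  have [simp]: "P [0, 2, 1, 1]" by (rule only_left[of 1 _ 2]) simp_all
  have [simp]: "\<not> P [1, 2, 2, 2]" by (rule exclude_mid[of "[1, 2, 2, 0]" "[1, 2, 0, 2]"]) simp_all
  have [simp]: "\<not> P [2, 2, 2, 2]" by (rule exclude_side[of "[2, 0, 2, 2]" "[2, 0, 2, 1]"]) simp_all
  have [simp]: "P [0, 2, 2, 2]" by (rule only_left[of 1 _ 2]) simp_all
  have [simp]: "\<not> P [0, 2, 1, 2]" by (rule exclude_mid[of "[0, 2, 1, 1]" "[0, 2, 2, 2]"]) simp_all
  have [simp]: "\<not> P [1, 2, 1, 2]" by (rule exclude_mid[of "[1, 2, 0, 2]" "[1, 0, 1, 2]"]) simp_all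
  have [simp]: "P [2, 2, 1, 2]" by (rule only_left[of 0 _ 1]) simp_all
  have [simp]: "\<not> P [0, 2, 2, 1]" by (rule exclude_mid[of "[0, 2, 1, 1]" "[0, 2, 2, 2]"]) simp_all
  have [simp]: "\<not> P [2, 2, 2, 1]" by (rule exclude_mid[of "[2, 2, 0, 1]" "[2, 0, 2, 1]"]) simp_all
  have [simp]: "P [1, 2, 2, 1]" by (rule only_left[of 0 _ 2]) simp_all
  show "P [2, 2, 1, 2]" "P [1, 2, 2, 1]" by simp_all
qed

text \<open>The points of weight 3 other than (1, 1, 1) and (2, 2, 2) form a hexagon. Each has two
  neighbours of weight 2 with value 2, hence lacks 2, and three consecutive ones cannot all have 0.
  So the points with 1 meet any three consecutive ones, and include two opposite points or every
  second point.\<close>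

lemma triangle_exceptional:
  assumes [simp]: "m = 3"
    and [simp]: "\<And>a b c. \<lbrakk>a \<noteq> 0; b \<noteq> 0\<rbrakk> \<Longrightarrow> P [c, a, b, 0] \<longleftrightarrow> c = a * b"
    and [simp]: "\<And>a b c. \<lbrakk>a \<noteq> 0; b \<noteq> 0\<rbrakk> \<Longrightarrow> P [c, a, 0, b] \<longleftrightarrow> c = a * b"
    and [simp]: "\<And>a b c. \<lbrakk>a \<noteq> 0; b \<noteq> 0\<rbrakk> \<Longrightarrow> P [c, 0, a, b] \<longleftrightarrow> c = a * b"
  shows "P [1, 1, 1, 2] \<and> P [1, 2, 2, 1] \<or> P [1, 1, 2, 1] \<and> P [1, 2, 1, 2] \<or> P [1, 2, 1, 1] \<and> P [1, 1, 2, 2]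
    \<or> P [1, 1, 1, 2] \<and> P [1, 1, 2, 1] \<and> P [1, 2, 1, 1] \<or> P [1, 2, 2, 1] \<and> P [1, 2, 1, 2] \<and> P [1, 1, 2, 2]"
proof -
  have [simp]: "\<not> P [2, 1, 1, 2]" by (rule exclude_mid[of "[2, 1, 0, 2]" "[2, 0, 1, 2]"]) simp_all
  have [simp]: "\<not> P [2, 1, 2, 1]" by (rule exclude_mid[of "[2, 1, 2, 0]" "[2, 0, 2, 1]"]) simp_all
  have [simp]: "\<not> P [2, 1, 2, 2]" by (rule exclude_mid[of "[2, 1, 2, 0]" "[2, 1, 0, 2]"]) simp_all
  have [simp]: "\<not> P [2, 2, 1, 1]" by (rule exclude_mid[of "[2, 2, 1, 0]" "[2, 2, 0, 1]"]) simp_all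
  have [simp]: "\<not> P [2, 2, 1, 2]" by (rule exclude_mid[of "[2, 2, 1, 0]" "[2, 0, 1, 2]"]) simp_all
  have [simp]: "\<not> P [2, 2, 2, 1]" by (rule exclude_mid[of "[2, 2, 0, 1]" "[2, 0, 2, 1]"]) simp_all
  have one: "P [1, a, b, d]" if "\<not> P [0, a, b, d]" "\<not> P [2, a, b, d]" for a b d
    by (rule only_left[OF that]) simp_all
  have c0: "P [1, 2, 1, 2] \<or> P [1, 1, 1, 2] \<or> P [1, 1, 2, 2]"
    using exclude_mid[of "[0, 2, 1, 2]" "[0, 1, 2, 2]" "[0, 1, 1, 2]"]
      one[of 2 1 2] one[of 1 1 2] one[of 1 2 2] by auto
  have c1: "P [1, 1, 1, 2] \<or> P [1, 1, 2, 2] \<or> P [1, 1, 2, 1]"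
    using exclude_mid[of "[0, 1, 1, 2]" "[0, 1, 2, 1]" "[0, 1, 2, 2]"]
      one[of 1 1 2] one[of 1 2 2] one[of 1 2 1] by auto
  have c2: "P [1, 1, 2, 2] \<or> P [1, 1, 2, 1] \<or> P [1, 2, 2, 1]"
    using exclude_mid[of "[0, 1, 2, 2]" "[0, 2, 2, 1]" "[0, 1, 2, 1]"]
      one[of 1 2 2] one[of 1 2 1] one[of 2 2 1] by auto
  have c3: "P [1, 1, 2, 1] \<or> P [1, 2, 2, 1] \<or> P [1, 2, 1, 1]"
    using exclude_mid[of "[0, 1, 2, 1]" "[0, 2, 1, 1]" "[0, 2, 2, 1]"]
      one[of 1 2 1] one[of 2 2 1] one[of 2 1 1] by auto
  have c4: "P [1, 2, 2, 1] \<or> P [1, 2, 1, 1] \<or> P [1, 2, 1, 2]"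
    using exclude_mid[of "[0, 2, 2, 1]" "[0, 2, 1, 2]" "[0, 2, 1, 1]"]
      one[of 2 2 1] one[of 2 1 1] one[of 2 1 2] by auto
  have c5: "P [1, 2, 1, 1] \<or> P [1, 2, 1, 2] \<or> P [1, 1, 1, 2]"
    using exclude_mid[of "[0, 2, 1, 1]" "[0, 1, 1, 2]" "[0, 2, 1, 2]"]
      one[of 2 1 1] one[of 2 1 2] one[of 1 1 2] by auto
  show ?thesis using c0 c1 c2 c3 c4 c5 by blast
qed

text \<open>Two points on coordinates 1 and 2 are matched in direction 3, and two points on
  coordinates 1 and 4 in direction 2. The exclusions end with the element 2 over (2, 1, 2, 2) and
  over two of its neighbours.\<close>

lemma adjacent_sharing:
  assumes [simp]: "m = 4"
    and [simp]: "\<And>a b c. \<lbrakk>a \<noteq> 0; b \<noteq> 0\<rbrakk> \<Longrightarrow> P [c, a, b, 0, 0] \<longleftrightarrow> c = a * b"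
    and [simp]: "\<And>a b c. \<lbrakk>a \<noteq> 0; b \<noteq> 0\<rbrakk> \<Longrightarrow> P [c, a, 0, b, 0] \<longleftrightarrow> c = a * b"
    and [simp]: "\<And>a b c. \<lbrakk>a \<noteq> 0; b \<noteq> 0\<rbrakk> \<Longrightarrow> P [c, 0, a, b, 0] \<longleftrightarrow> c = a * b"
    and [simp]: "\<And>a b c. \<lbrakk>a \<noteq> 0; b \<noteq> 0\<rbrakk> \<Longrightarrow> P [c, a, 0, 0, b] \<longleftrightarrow> c = a * b"
    and [simp]: "\<And>a b c. \<lbrakk>a \<noteq> 0; b \<noteq> 0\<rbrakk> \<Longrightarrow> P [c, 0, a, 0, b] \<longleftrightarrow> c = a * b"
    and [simp]: "P [1, 1, 1, 2, 0]" "P [1, 2, 2, 1, 0]" "P [1, 1, 2, 0, 1]" "P [1, 2, 1, 0, 2]"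
  shows False
proof -
  have [simp]: "\<not> P [1, 2, 1, 2, 0]" by (rule exclude_side[of "[1, 1, 1, 2, 0]" "[1, 1, 1, 0, 0]"]) simp_all
  have [simp]: "\<not> P [2, 2, 1, 2, 0]" by (rule exclude_mid[of "[2, 2, 1, 0, 0]" "[2, 0, 1, 2, 0]"]) simp_all
  have [simp]: "P [0, 2, 1, 2, 0]" by (rule only_left[of 1 _ 2]) simp_all
  have [simp]: "\<not> P [1, 2, 1, 1, 0]" by (rule exclude_side[of "[1, 2, 2, 1, 0]" "[1, 2, 2, 0, 0]"]) simp_all
  have [simp]: "\<not> P [2, 2, 1, 1, 0]" by (rule exclude_mid[of "[2, 2, 1, 0, 0]" "[2, 2, 0, 1, 0]"]) simp_all
  have [simp]: "P [0, 2, 1, 1, 0]" by (rule only_left[of 1 _ 2]) simp_all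
  have [simp]: "\<not> P [0, 2, 1, 2, 2]" by (rule exclude_side[of "[0, 2, 1, 2, 0]" "[0, 2, 1, 1, 0]"]) simp_all
  have [simp]: "\<not> P [1, 2, 1, 2, 2]" by (rule exclude_side[of "[1, 2, 1, 0, 2]" "[1, 2, 0, 0, 2]"]) simp_all
  have [simp]: "P [2, 2, 1, 2, 2]" by (rule only_left[of 0 _ 1]) simp_all
  have [simp]: "\<not> P [1, 1, 1, 0, 2]" by (rule exclude_side[of "[1, 1, 1, 0, 0]" "[1, 1, 1, 2, 0]"]) simp_all
  have [simp]: "\<not> P [2, 1, 1, 0, 2]" by (rule exclude_mid[of "[2, 1, 0, 0, 2]" "[2, 0, 1, 0, 2]"]) simp_all
  have [simp]: "P [0, 1, 1, 0, 2]" by (rule only_left[of 1 _ 2]) simp_all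
  have [simp]: "\<not> P [1, 1, 2, 0, 2]" by (rule exclude_side[of "[1, 1, 2, 0, 1]" "[1, 1, 0, 0, 1]"]) simp_all
  have [simp]: "\<not> P [2, 1, 2, 0, 2]" by (rule exclude_mid[of "[2, 1, 2, 0, 0]" "[2, 1, 0, 0, 2]"]) simp_all
  have [simp]: "P [0, 1, 2, 0, 2]" by (rule only_left[of 1 _ 2]) simp_all
  have [simp]: "\<not> P [0, 1, 1, 2, 2]" by (rule exclude_side[of "[0, 1, 1, 0, 2]" "[0, 1, 2, 0, 2]"]) simp_all
  have [simp]: "\<not> P [1, 1, 1, 2, 2]" by (rule exclude_side[of "[1, 1, 1, 2, 0]" "[1, 1, 1, 0, 0]"]) simp_all
  have [simp]: "P [2, 1, 1, 2, 2]" by (rule only_left[of 0 _ 1]) simp_all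
  have [simp]: "\<not> P [0, 2, 1, 1, 2]" by (rule exclude_side[of "[0, 2, 1, 1, 0]" "[0, 2, 1, 2, 0]"]) simp_all
  have [simp]: "\<not> P [1, 2, 1, 1, 2]" by (rule exclude_side[of "[1, 2, 1, 0, 2]" "[1, 2, 0, 0, 2]"]) simp_all
  have [simp]: "P [2, 2, 1, 1, 2]" by (rule only_left[of 0 _ 1]) simp_all
  have "\<not> P [2, 2, 1, 1, 2]" by (rule exclude_side[of "[2, 2, 1, 2, 2]" "[2, 1, 1, 2, 2]"]) simp_all
  then show False by simp
qed

end

section \<open>Coordinates of a set fibred over all points\<close>

definition pt :: "nat list \<Rightarrow> 3 list \<Rightarrow> nat \<Rightarrow> 3" where
  "pt ks vs = (\<lambda>j. case map_of (zip ks vs) j of None \<Rightarrow> 0 | Some v \<Rightarrow> v)"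

lemma pt_Nil [simp]: "pt [] vs = (\<lambda>_. 0)"
  by (simp add: pt_def)

lemma pt_Cons: "pt (i # ks) (v # vs) = (pt ks vs)(i := v)"
  by (auto simp: pt_def fun_eq_iff)

lemma pt_inject:
  "\<lbrakk>distinct ks; length vs = length ks; length ws = length ks; pt ks vs = pt ks ws\<rbrakk> \<Longrightarrow> vs = ws"
proof (induction ks arbitrary: vs ws)
  case (Cons i ks)
  then obtain v vs' w ws' where [simp]: "vs = v # vs'" "ws = w # ws'"
    by (metis length_Suc_conv)
  have zero: "pt ks us i = 0" if "length us = length ks" for us
    using that Cons.prems(1) by (simp add: pt_def split: option.split) (metis map_of_SomeD set_zip_leftD)
  have "v = w" using Cons.prems(4) by (auto simp: pt_Cons dest: fun_cong[of _ _ i])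
  moreover have "pt ks vs' = pt ks ws'"
  proof
    fix j
    show "pt ks vs' j = pt ks ws' j"
      using fun_cong[OF Cons.prems(4), of j] zero[of vs'] zero[of ws'] Cons.prems(2,3)
      by (cases "j = i") (simp_all add: pt_Cons)
  qed
  ultimately show ?case using Cons by simp
qed simp

lemma pt_notin: "i \<notin> set ks \<Longrightarrow> pt ks vs i = 0"
  by (auto simp: pt_def split: option.split dest: map_of_SomeD set_zip_leftD)

lemma pt_zero:
  "i \<notin> set ks \<Longrightarrow> pt (i # ks) (0 # vs) = pt ks vs"
  "j \<notin> set ks \<Longrightarrow> pt (i # j # ks) (a # 0 # vs) = pt (i # ks) (a # vs)"
  "k \<notin> set ks \<Longrightarrow> pt (i # j # k # ks) (a # b # 0 # vs) = pt (i # j # ks) (a # b # vs)"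
  "l \<notin> set ks \<Longrightarrow> pt (i # j # k # l # ks) (a # b # c # 0 # vs) = pt (i # j # k # ks) (a # b # c # vs)"
  by (simp_all add: pt_Cons pt_notin fun_upd_idem)

lemma pt_swap:
  "i \<noteq> j \<Longrightarrow> pt (i # j # ks) (a # b # vs) = pt (j # i # ks) (b # a # vs)"
  "j \<noteq> k \<Longrightarrow> pt (i # j # k # ks) (a # b # c # vs) = pt (i # k # j # ks) (a # c # b # vs)"
  by (simp_all add: pt_Cons fun_upd_twist)

lemma adjl_length: "adjl xs ys \<Longrightarrow> length xs = length ys"
  by (induction xs ys rule: adjl.induct) (auto split: if_splits)

lemma adjl_pt:
  "\<lbrakk>distinct ks; length vs = length ks; adjl vs ws\<rbrakk>
    \<Longrightarrow> \<exists>i\<in>set ks. \<exists>a. a \<noteq> pt ks vs i \<and> pt ks ws = (pt ks vs)(i := a)"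
proof (induction ks arbitrary: vs ws)
  case (Cons i ks)
  then obtain v vs' w ws' where [simp]: "vs = v # vs'" "ws = w # ws'"
    by (metis adjl_length length_Suc_conv)
  show ?case
  proof (cases "v = w")
    case True
    with Cons obtain j a where j: "j \<in> set ks" "a \<noteq> pt ks vs' j" "pt ks ws' = (pt ks vs')(j := a)"
      by force
    have "j \<noteq> i" using j(1) Cons.prems(1) by auto
    with j True show ?thesis by (intro bexI[of _ j] exI[of _ a]) (auto simp: pt_Cons fun_upd_twist)
  next
    case False
    with Cons show ?thesis by (intro bexI[of _ i] exI[of _ w]) (auto simp: pt_Cons)
  qed
qed auto

lemma adjl_map2_mult:
  "\<lbrakk>length vs = length us; 0 \<notin> set us; adjl vs ws\<rbrakk> \<Longrightarrow> adjl (map2 (*) us vs) (map2 (*) us (ws :: 3 list))"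
proof (induction us arbitrary: vs ws)
  case (Cons u us)
  then obtain v vs' w ws' where "vs = v # vs'" "ws = w # ws'"
    by (metis adjl_length length_Suc_conv)
  with Cons show ?case by (auto simp: mult_left_cancel_Z3 split: if_splits)
qed simp

lemma map2_mult_inject:
  "\<lbrakk>length vs = length us; length ws = length us; 0 \<notin> set us; map2 (*) us vs = map2 (*) us ws\<rbrakk>
    \<Longrightarrow> vs = (ws :: 3 list)"
proof (induction us arbitrary: vs ws)
  case (Cons u us)
  then obtain v vs' w ws' where "vs = v # vs'" "ws = w # ws'"
    by (metis length_Suc_conv)
  with Cons show ?case by (auto simp: mult_left_cancel_Z3)
qed simp

text \<open>
  Multiplying the coordinates by the units \<open>us\<close> and the elements of the fibres by \<open>w\<close> preserves
  adjacency.
\<close>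

definition rescaled :: "((nat \<Rightarrow> 3) \<Rightarrow> 3 set) \<Rightarrow> nat list \<Rightarrow> 3 list \<Rightarrow> 3 \<Rightarrow> 3 list \<Rightarrow> bool" where
  "rescaled g ks us w p \<longleftrightarrow> w * hd p \<in> g (pt ks (map2 (*) us (tl p)))"

lemma rescaled_Cons [simp]: "rescaled g ks us w (c # vs) \<longleftrightarrow> w * c \<in> g (pt ks (map2 (*) us vs))"
  by (simp add: rescaled_def)

text \<open>The degree bound, split by whether the two edges at a point stay in its fibre or change
  the base point: one of each, both inside, both across.\<close>

locale degree1_section =
  fixes J :: "nat set" and g :: "(nat \<Rightarrow> 3) \<Rightarrow> 3 set"
  assumes nonempty: "g x \<noteq> {}"
    and vertical: "\<lbrakk>c \<in> g x; d \<in> g x; c \<noteq> d; i \<in> J; a \<noteq> x i\<rbrakk> \<Longrightarrow> c \<notin> g (x(i := a))"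
    and not_full: "\<lbrakk>c \<in> g x; d \<in> g x; e \<in> g x; c \<noteq> d; c \<noteq> e\<rbrakk> \<Longrightarrow> d = e"
    and horizontal: "\<lbrakk>c \<in> g x; c \<in> g (x(i := a)); c \<in> g (x(j := b)); i \<in> J; j \<in> J; a \<noteq> x i; b \<noteq> x j\<rbrakk>
      \<Longrightarrow> x(i := a) = x(j := b)"
    and origin: "g (\<lambda>_. 0) = {1, 2}"
begin

text \<open>This transfers the low-dimensional lemmas to arbitrary coordinates \<open>ks\<close>.
  Multiplication by units is injective, so adjacent lists give adjacent points.\<close>

lemma grid_rescaled:
  assumes dk: "distinct ks" "set ks \<subseteq> J" and us: "length us = length ks" "0 \<notin> set us" and w: "w \<noteq> 0"
  shows "grid (length ks) (rescaled g ks us w)"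
proof
  fix vs :: "3 list"
  obtain c where "c \<in> g (pt ks (map2 (*) us vs))" using nonempty by blast
  then show "\<exists>c. rescaled g ks us w (c # vs)" using w
    by (intro exI[of _ "w * c"]) (simp add: square_left_Z3)
next
  fix p q r
  assume len: "length p = Suc (length ks)"
    and P: "rescaled g ks us w p" "rescaled g ks us w q" "rescaled g ks us w r"
    and adj: "adjl p q" "adjl p r"
  let ?x = "\<lambda>p. pt ks (map2 (*) us (tl p))"
  obtain c vs d qs e rs where p: "p = c # vs" and q: "q = d # qs" and r: "r = e # rs"
    using len adj[THEN adjl_length] by (metis length_Suc_conv)
  have [simp]: "length vs = length ks" "length qs = length ks" "length rs = length ks"
    using len adj[THEN adjl_length] by (simp_all add: p q r)
  have move: "\<exists>i\<in>J. \<exists>a. a \<noteq> ?x p i \<and> pt ks (map2 (*) us ws) = (?x p)(i := a)" if "adjl vs ws" for ws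
    using adjl_pt[OF dk(1) _ adjl_map2_mult[OF _ us(2) that]] us(1) dk(2) by (auto simp: p)
  have cases: "d \<noteq> c \<and> qs = vs \<or> d = c \<and> adjl vs qs" "e \<noteq> c \<and> rs = vs \<or> e = c \<and> adjl vs rs"
    using adj by (auto simp: p q r split: if_splits)
  have wc: "w * a = w * b \<longleftrightarrow> a = b" for a b using w by (rule mult_left_cancel_Z3)
  note P' = P[unfolded p q r rescaled_Cons]
  have no_step: False
    if st: "b \<noteq> c" "w * b \<in> g (pt ks (map2 (*) us vs))" "adjl vs ws" "w * c \<in> g (pt ks (map2 (*) us ws))" for b ws
  proof -
    obtain i a where i: "i \<in> J" "a \<noteq> ?x p i" "pt ks (map2 (*) us ws) = (?x p)(i := a)"
      using move[OF st(3)] by (elim bexE exE conjE) (rule that)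
    have "w * c \<noteq> w * b" using st(1) by (simp add: wc)
    then have "w * c \<notin> g ((?x p)(i := a))"
      using vertical[of "w * c" "?x p" "w * b" i a] P'(1) st(2) i by (simp add: p)
    then show False using st(4) i(3) by simp
  qed
  \<comment> \<open>The letters tell for each edge at \<open>p\<close> whether it is vertical,
    inside the fibre, or horizontal; \<open>no_step\<close> settles the mixed cases.\<close>
  consider (vv) "d \<noteq> c" "qs = vs" "e \<noteq> c" "rs = vs" | (vh) "d \<noteq> c" "qs = vs" "e = c" "adjl vs rs"
    | (hv) "d = c" "adjl vs qs" "e \<noteq> c" "rs = vs" | (hh) "d = c" "adjl vs qs" "e = c" "adjl vs rs"
    using cases by blast
  then show "q = r"
  proof cases
    case vv
    then show ?thesis using not_full[of "w * c" _ "w * d" "w * e"] P' wc by (auto simp: q r)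
  next
    case vh
    then show ?thesis using no_step[of d rs] P' by simp
  next
    case hv
    then show ?thesis using no_step[of e qs] P' by simp
  next
    case hh
    obtain i a where i: "i \<in> J" "a \<noteq> ?x p i" "?x q = (?x p)(i := a)" using move[OF hh(2)] by (auto simp: q)
    obtain j b where j: "j \<in> J" "b \<noteq> ?x p j" "?x r = (?x p)(j := b)" using move[OF hh(4)] by (auto simp: r)
    have "?x q = ?x r"
      unfolding i(3) j(3)
    proof (rule horizontal)
      show "w * c \<in> g (?x p)" using P'(1) by (simp add: p)
      show "w * c \<in> g ((?x p)(i := a))" using P'(2) hh(1) unfolding i(3)[symmetric] by (simp add: q)
      show "w * c \<in> g ((?x p)(j := b))" using P'(3) hh(3) unfolding j(3)[symmetric] by (simp add: r)
    qed (fact i j)+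
    then have "map2 (*) us qs = map2 (*) us rs"
      using pt_inject[OF dk(1), of "map2 (*) us qs" "map2 (*) us rs"] us(1) by (simp add: q r)
    then have "qs = rs" using map2_mult_inject[of qs us rs] us by simp
    then show ?thesis using hh by (simp add: q r)
  qed
qed

section \<open>Alternating and directed pairs\<close>

definition alternating :: "3 \<Rightarrow> nat \<Rightarrow> nat \<Rightarrow> bool" where
  "alternating e i j \<longleftrightarrow> e \<noteq> 0 \<and> (\<forall>a b. a \<noteq> 0 \<longrightarrow> b \<noteq> 0 \<longrightarrow> g (pt [i, j] [a, b]) = {e * a * b})"

definition directed :: "3 \<Rightarrow> nat \<Rightarrow> nat \<Rightarrow> bool" where
  "directed s i j \<longleftrightarrow> s \<noteq> 0 \<and> (\<forall>a b. a \<noteq> 0 \<longrightarrow> b \<noteq> 0 \<longrightarrow> g (pt [i, j] [a, b]) = {s * a})"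

definition alt :: "nat \<Rightarrow> nat \<Rightarrow> bool" where "alt i j \<longleftrightarrow> (\<exists>e. alternating e i j)"

definition dir :: "nat \<Rightarrow> nat \<Rightarrow> bool" where "dir i j \<longleftrightarrow> (\<exists>s. directed s i j)"

lemma alternatingD:
  assumes "alternating e i j"
  shows "e \<noteq> 0" "\<lbrakk>a \<noteq> 0; b \<noteq> 0\<rbrakk> \<Longrightarrow> g (pt [i, j] [a, b]) = {e * a * b}"
  using assms by (auto simp: alternating_def)

lemma directedD:
  assumes "directed s i j"
  shows "s \<noteq> 0" "\<lbrakk>a \<noteq> 0; b \<noteq> 0\<rbrakk> \<Longrightarrow> g (pt [i, j] [a, b]) = {s * a}"
  using assms by (auto simp: directed_def)

lemma alternating_sym: "\<lbrakk>alternating e i j; i \<noteq> j\<rbrakk> \<Longrightarrow> alternating e j i"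
  by (auto simp: alternating_def pt_swap(1)[of j i] ac_simps)

lemma alt_sym: "\<lbrakk>alt i j; i \<noteq> j\<rbrakk> \<Longrightarrow> alt j i"
  by (auto simp: alt_def dest: alternating_sym)

lemma alternating_unique: "\<lbrakk>alternating e i j; alternating e' i j\<rbrakk> \<Longrightarrow> e = e'"
  by (auto dest!: alternatingD(2)[of _ i j 1 1])

lemma directed_unique: "\<lbrakk>directed s i j; directed s' i j\<rbrakk> \<Longrightarrow> s = s'"
  by (auto dest!: directedD(2)[of _ i j 1 1])

lemma dir_antisym: "\<lbrakk>dir i j; dir j i; i \<noteq> j\<rbrakk> \<Longrightarrow> False"
  unfolding dir_def
proof (elim exE)
  fix t s assume "directed t j i" "directed s i j" "i \<noteq> j"
  then have "s = t" "s = t * 2" "s \<noteq> 0"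
    using directedD(2)[of t j i 1 1] directedD(2)[of t j i 2 1] directedD(1)[of s i j]
      directedD(2)[of s i j 1 1] directedD(2)[of s i j 1 2] pt_swap(1)[of i j "[]" _ _ "[]"]
    by auto
  then show False by (simp add: ac_simps)
qed

lemma pair_cases:
  assumes "i \<in> J" "j \<in> J" "i \<noteq> j"
  obtains "alt i j" | "dir i j" | "dir j i"
proof -
  interpret G: grid 2 "rescaled g [i, j] [1, 1] 1"
    using grid_rescaled[of "[i, j]" "[1, 1]" 1] assms by (simp add: numeral_2_eq_2)
  have set_eq: "(\<And>c. c \<in> A \<longleftrightarrow> c = x) \<Longrightarrow> A = {x}" for A and x :: 3 by auto
  show thesis
  proof (rule G.weight2_cases)
    fix s :: 3 assume s: "s \<noteq> 0" and *: "\<And>a b c. \<lbrakk>a \<noteq> 0; b \<noteq> 0\<rbrakk> \<Longrightarrow> rescaled g [i, j] [1, 1] 1 [c, a, b] = (c = s * a * b)"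
    have "alternating s i j"
      unfolding alternating_def using s * by (auto intro!: set_eq)
    then show thesis using that(1) by (auto simp: alt_def)
  next
    fix s :: 3 assume s: "s \<noteq> 0" and *: "\<And>a b c. \<lbrakk>a \<noteq> 0; b \<noteq> 0\<rbrakk> \<Longrightarrow> rescaled g [i, j] [1, 1] 1 [c, a, b] = (c = s * a)"
    have "directed s i j"
      unfolding directed_def using s * by (auto intro!: set_eq)
    then show thesis using that(2) by (auto simp: dir_def)
  next
    fix s :: 3 assume s: "s \<noteq> 0" and *: "\<And>a b c. \<lbrakk>a \<noteq> 0; b \<noteq> 0\<rbrakk> \<Longrightarrow> rescaled g [i, j] [1, 1] 1 [c, a, b] = (c = s * b)"
    have "directed s j i"
      unfolding directed_def using s * assms(3) by (auto intro!: set_eq simp: pt_swap(1)[of j i])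
    then show thesis using that(3) by (auto simp: dir_def)
  qed (simp_all add: pt_zero origin)
qed

section \<open>Sign and orientation constraints on three coordinates\<close>

lemma directed_same_sign:
  assumes "directed s i j" "directed t i k" "{i, j, k} \<subseteq> J" "distinct [i, j, k]"
  shows "s = t"
proof (rule ccontr)
  assume "s \<noteq> t"
  with assms have t: "t = 2 * s"
    using exhaust_Z3[of s] exhaust_Z3[of t] directedD(1) by auto
  note [simp] = directedD[OF assms(1)] directedD[OF assms(2)]
  \<comment> \<open>Scaling the fibres by \<open>s\<close> turns the signs \<open>s\<close> and
    \<open>2 * s\<close> into 1 and 2.\<close>
  interpret G: grid 3 "rescaled g [i, j, k] [1, 1, 1] s"
    using grid_rescaled[of "[i, j, k]" "[1, 1, 1]" s] assms by (simp add: numeral_3_eq_3)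
  show False
    by (rule G.sources_same_sign) (use assms(4) in \<open>simp_all add: pt_zero Z3_simps t\<close>)
qed

lemma no_directed_cycle:
  assumes "dir i j" "dir j k" "dir k i" "{i, j, k} \<subseteq> J" "distinct [i, j, k]"
  shows False
proof -
  obtain s t r where "directed s i j" "directed t j k" "directed r k i"
    using assms by (auto simp: dir_def)
  note [simp] = this[THEN directedD(1)] this[THEN directedD(2)]
  interpret G: grid 3 "rescaled g [i, j, k] [s, t, r] 1"
    using grid_rescaled[of "[i, j, k]" "[s, t, r]" 1] assms by (simp add: numeral_3_eq_3)
  show False
    by (rule G.directed_cycle)
      (use assms(5) in \<open>simp_all add: pt_zero Z3_simps pt_swap(1)[of i k "[]"]\<close>)
qed

text \<open>Scaling \<open>i\<close> by \<open>s\<close> and \<open>j\<close> by \<open>t\<close>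
  makes both directed signs 1 and the alternating sign \<open>e * s * t\<close>, whose two values
  are the two cases.\<close>

lemma alt_not_to_sink:
  assumes "alt i j" "dir i k" "dir j k" "{i, j, k} \<subseteq> J" "distinct [i, j, k]"
  shows False
proof -
  obtain e s t where "alternating e i j" and "directed s i k" "directed t j k"
    using assms by (auto simp: dir_def alt_def)
  note [simp] = alternatingD[OF this(1)] this(2-)[THEN directedD(1)] this(2-)[THEN directedD(2)]
  interpret G: grid 3 "rescaled g [i, j, k] [s, t, 1] 1"
    using grid_rescaled[of "[i, j, k]" "[s, t, 1]" 1] assms by (simp add: numeral_3_eq_3)
  have "e = 1 \<or> e = 2" "s = 1 \<or> s = 2" "t = 1 \<or> t = 2" by (simp_all flip: nonzero_Z3)
  then consider "e = s * t" | "e = 2 * s * t" by (elim disjE) simp_all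
  then show False
  proof cases
    case 1
    show False
      by (rule G.alternating_to_sink_pos) (use assms(5) 1 in \<open>simp_all add: pt_zero Z3_simps\<close>)
  next
    case 2
    show False
      by (rule G.alternating_to_sink_neg) (use assms(5) 2 in \<open>simp_all add: pt_zero Z3_simps\<close>)
  qed
qed

lemma alt_not_path_through:
  assumes "alt i j" "dir i k" "dir k j" "{i, j, k} \<subseteq> J" "distinct [i, j, k]"
  shows False
proof -
  obtain e s t where "alternating e i j" and "directed s i k" "directed t k j"
    using assms by (auto simp: dir_def alt_def)
  note [simp] = alternatingD[OF this(1)] this(2-)[THEN directedD(1)] this(2-)[THEN directedD(2)]
  \<comment> \<open>The factor \<open>e * s\<close> on \<open>j\<close> absorbs both
    \<open>e\<close> and the factor on \<open>i\<close>.\<close>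
  interpret G: grid 3 "rescaled g [i, j, k] [s, e * s, t] 1"
    using grid_rescaled[of "[i, j, k]" "[s, e * s, t]" 1] assms by (simp add: numeral_3_eq_3)
  show False
    by (rule G.alternating_path_through)
      (use assms(5) in \<open>simp_all add: pt_zero Z3_simps pt_swap(1)[of j k "[]"]\<close>)
qed

text \<open>Otherwise \<open>k\<close> is a sink for both ends or the middle of a directed path
  between them.\<close>

lemma alt_dominated:
  assumes "alt i j" "\<not> alt i k" "\<not> alt j k" "{i, j, k} \<subseteq> J" "distinct [i, j, k]"
  shows "dir k i" "dir k j"
proof -
  have "dir i k \<or> dir k i" "dir j k \<or> dir k j"
    using pair_cases[of i k] pair_cases[of j k] assms by auto
  then show "dir k i" "dir k j"
    using alt_not_to_sink[of i j k] alt_not_path_through[of i j k] alt_not_path_through[of j i k]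
      alt_sym[of i j] assms by auto
qed

text \<open>
  The two points of the pair \<open>c, j\<close> with \<open>c\<close>-coordinate \<open>2 e s\<close> are matched in direction \<open>k\<close>. This
  coordinate does not depend on \<open>k\<close>, hence there can be only one such \<open>k\<close>.
\<close>

lemma exceptional:
  assumes "alternating e c j" "alternating e' c k" "directed s j k" "{c, j, k} \<subseteq> J" "distinct [c, j, k]"
    and "b \<noteq> 0"
  obtains d where "d \<noteq> 0" "2 * s * b \<in> g (pt [c, j, k] [2 * e * s, b, d])"
proof -
  note [simp] = alternatingD[OF assms(1)] alternatingD[OF assms(2)] directedD[OF assms(3)]
  \<comment> \<open>These units turn the three signs into 1; the coordinate 2 in
    \<open>cherry_exceptional\<close> becomes \<open>2 * e * s\<close>.\<close>
  interpret G: grid 3 "rescaled g [c, j, k] [e * s, s, e * e' * s] 1"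
    using grid_rescaled[of "[c, j, k]" "[e * s, s, e * e' * s]" 1] assms by (simp add: numeral_3_eq_3)
  have *: "rescaled g [c, j, k] [e * s, s, e * e' * s] 1 [2, 2, 1, 2]"
    "rescaled g [c, j, k] [e * s, s, e * e' * s] 1 [1, 2, 2, 1]"
    by (rule G.cherry_exceptional; use assms(5) in \<open>simp add: pt_zero Z3_simps\<close>)+
  have "b = s \<or> b = 2 * s"
    using exhaust_Z3[of b] exhaust_Z3[of s] \<open>b \<noteq> 0\<close> directedD(1)[OF assms(3)] by auto
  then show thesis
  proof
    assume "b = s"
    then show thesis using that[of "e * e' * s * 2"] *(1) by (simp add: Z3_simps)
  next
    assume "b = 2 * s"
    then show thesis using that[of "e * e' * s"] *(2) by (simp add: Z3_simps)
  qed
qed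


section \<open>Configurations on four coordinates\<close>

lemma two_extensions:
  assumes "v \<in> g (pt [i, j] [a, b])" "v \<in> g (pt [i, j, k] [a, b, c])" "v \<in> g (pt [i, j, l] [a, b, d])"
    and "c \<noteq> 0" "d \<noteq> 0" "{i, j, k, l} \<subseteq> J" "distinct [i, j, k, l]"
  shows False
proof -
  interpret G: grid 4 "rescaled g [i, j, k, l] [1, 1, 1, 1] 1"
    using grid_rescaled[of "[i, j, k, l]" "[1, 1, 1, 1]" 1] assms by (simp add: eval_nat_numeral)
  show False
    using G.deg[of "[v, a, b, 0, 0]" "[v, a, b, c, 0]" "[v, a, b, 0, d]"] assms by (simp add: pt_zero)
qed

text \<open>The pairs out of \<open>j\<close> have the same sign, so the same point on
  \<open>c, j\<close> would be matched in directions \<open>k\<close> and \<open>l\<close>.\<close>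

lemma no_alt_star_with_source:
  assumes "alt c j" "alt c k" "alt c l" "dir j k" "dir j l" "{c, j, k, l} \<subseteq> J" "distinct [c, j, k, l]"
  shows False
proof -
  obtain e e1 e2 s t where e: "alternating e c j" "alternating e1 c k" "alternating e2 c l"
    and s: "directed s j k" "directed t j l"
    using assms by (auto simp: alt_def dir_def)
  have [simp]: "t = s" using directed_same_sign[OF s] assms by simp
  obtain d where d: "d \<noteq> 0" "2 * s * 1 \<in> g (pt [c, j, k] [2 * e * s, 1, d])"
    using exceptional[OF e(1,2) s(1), of 1] assms by auto
  obtain d' where d': "d' \<noteq> 0" "2 * s * 1 \<in> g (pt [c, j, l] [2 * e * s, 1, d'])"
    using exceptional[OF e(1,3) s(2), of 1] assms by auto
  show False
    by (rule two_extensions[OF _ d(2) d'(2)])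
      (use assms d(1) d'(1) alternatingD[OF e(1)] directedD(1)[OF s(1)] in \<open>simp_all add: Z3_simps\<close>)
qed

text \<open>On \<open>i, j\<close>, the points with \<open>i\<close>-coordinate
  \<open>2 * e * s\<close> are matched in direction \<open>l\<close>, those with
  \<open>j\<close>-coordinate \<open>2 * e * t\<close> in direction \<open>k\<close>. One point has
  both coordinates.\<close>

lemma no_alt_path_with_diagonals:
  assumes "alt i j" "alt i l" "alt j k" "dir j l" "dir i k" "{i, j, k, l} \<subseteq> J" "distinct [i, j, k, l]"
  shows False
proof -
  obtain e e1 e2 s t where e: "alternating e i j" "alternating e1 i l" "alternating e2 j k"
    and s: "directed s j l" "directed t i k"
    using assms by (auto simp: alt_def dir_def)
  note [simp] = alternatingD[OF e(1)] directedD(1)[OF s(1)] directedD(1)[OF s(2)]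
  obtain d where d: "d \<noteq> 0" "2 * s * (2 * e * t) \<in> g (pt [i, j, l] [2 * e * s, 2 * e * t, d])"
    using exceptional[OF e(1,2) s(1), of "2 * e * t"] assms by auto
  have "alternating e j i" using alternating_sym[OF e(1)] assms by simp
  then obtain d' where d': "d' \<noteq> 0" "2 * t * (2 * e * s) \<in> g (pt [j, i, k] [2 * e * t, 2 * e * s, d'])"
    using exceptional[OF _ e(3) s(2), of e "2 * e * s"] assms by auto
  have d'_swap: "2 * s * (2 * e * t) \<in> g (pt [i, j, k] [2 * e * s, 2 * e * t, d'])"
    using d'(2) assms pt_swap(1)[of i j "[k]"] by (simp add: ac_simps)
  show False
    by (rule two_extensions[OF _ d(2) d'_swap]) (use assms d(1) d'(1) in \<open>simp_all add: Z3_simps\<close>)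
qed

section \<open>Cliques of alternating pairs\<close>

definition sgn :: "nat \<Rightarrow> nat \<Rightarrow> 3" where "sgn i j = (SOME e. alternating e i j)"

text \<open>The coboundary of \<open>sgn\<close>: negating a coordinate changes two of the three
  factors, so the product is invariant.\<close>

definition tri :: "nat \<Rightarrow> nat \<Rightarrow> nat \<Rightarrow> 3" where "tri i j k = sgn i j * sgn i k * sgn j k"

text \<open>
  Of the four points of weight 2 on \<open>i, j\<close>, two have the value \<open>tri i j k\<close>, one for each nonzero
  \<open>i\<close>-coordinate \<open>a\<close>. The condition says that this point is matched in direction \<open>k\<close>.
\<close>

definition exc :: "nat \<Rightarrow> nat \<Rightarrow> nat \<Rightarrow> 3 \<Rightarrow> bool" where
  "exc i j k a \<longleftrightarrow>
    tri i j k \<in> g (pt [i, j, k] [a, tri i j k * sgn i j * a, 2 * tri i j k * sgn i k * a])"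

definition clique :: "nat set \<Rightarrow> bool" where
  "clique K \<longleftrightarrow> K \<subseteq> J \<and> (\<forall>i\<in>K. \<forall>j\<in>K. i \<noteq> j \<longrightarrow> alt i j)"

lemma alternating_sgn: "alt i j \<Longrightarrow> alternating (sgn i j) i j"
  unfolding sgn_def alt_def by (rule someI_ex)

lemma sgn_nonzero: "alt i j \<Longrightarrow> sgn i j \<noteq> 0"
  using alternating_sgn alternatingD(1) by blast

lemma sgn_sym: "\<lbrakk>alt i j; i \<noteq> j\<rbrakk> \<Longrightarrow> sgn j i = sgn i j"
  by (metis alternating_sgn alternating_sym alternating_unique alt_sym)

context
  fixes K
  assumes K: "clique K"
begin

lemma clique_alt: "\<lbrakk>i \<in> K; j \<in> K; i \<noteq> j\<rbrakk> \<Longrightarrow> alt i j" "i \<in> K \<Longrightarrow> i \<in> J"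
  using K by (auto simp: clique_def)

lemma tri_sym:
  assumes "{i, j, k} \<subseteq> K" "distinct [i, j, k]"
  shows "tri j i k = tri i j k" "tri i k j = tri i j k" "tri j k i = tri i j k"
  using assms sgn_sym[of i j] sgn_sym[of i k] sgn_sym[of j k] clique_alt
  by (auto simp: tri_def ac_simps)

text \<open>Both sides speak of the same point, indexed by its \<open>j\<close>-coordinate and by
  its \<open>i\<close>-coordinate.\<close>

lemma exc_swap:
  assumes "{i, j, k} \<subseteq> K" "distinct [i, j, k]"
  shows "exc j i k (tri i j k * sgn i j * a) \<longleftrightarrow> exc i j k a"
proof -
  have *: "sgn j i = sgn i j" "tri j i k = tri i j k"
    using assms tri_sym sgn_sym clique_alt by auto
  have [simp]: "sgn i j \<noteq> 0" "sgn i k \<noteq> 0" "sgn j k \<noteq> 0"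
    using sgn_nonzero clique_alt assms by auto
  show ?thesis
    using assms(2) unfolding exc_def *
    by (simp add: tri_def Z3_simps pt_swap(1)[of j i "[k]"])
qed

text \<open>Opposite points of the hexagon belong to the same pair, which gives the first three
  cases. Every second point gives one point on each pair, with a common \<open>i\<close>-coordinate
  on the two pairs containing \<open>i\<close>.\<close>

lemma triangle_exc:
  assumes "{i, j, k} \<subseteq> K" "distinct [i, j, k]"
  shows "exc i j k 1 \<and> exc i j k 2 \<or> exc i k j 1 \<and> exc i k j 2 \<or> exc j k i 1 \<and> exc j k i 2
    \<or> (\<exists>a. a \<noteq> 0 \<and> exc i j k a \<and> exc i k j a)"
proof -
  define e f h where efh: "e = sgn i j" "f = sgn i k" "h = sgn j k"
  have "alternating e i j" "alternating f i k" "alternating h j k"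
    unfolding efh using assms alternating_sgn clique_alt by auto
  note [simp] = this[THEN alternatingD(1)] this[THEN alternatingD(2)]
  have [simp]: "sgn i j = e" "sgn i k = f" "sgn j k = h" "sgn j i = e" "sgn k i = f" "sgn k j = h"
    unfolding efh using assms sgn_sym clique_alt by auto
  \<comment> \<open>After scaling the coordinates, all three signs equal \<open>e * f * h\<close>,
    which the scaling of the fibres removes.\<close>
  let ?P = "rescaled g [i, j, k] [1, f * h, e * h] (e * f * h)"
  interpret G: grid 3 ?P
    using grid_rescaled[of "[i, j, k]" "[1, f * h, e * h]" "e * f * h"] assms clique_alt(2)
    by (simp add: numeral_3_eq_3)
  have eq: "?P [1, 1, 1, 2] = exc i j k 1" "?P [1, 2, 2, 1] = exc i j k 2"
    "?P [1, 1, 2, 1] = exc i k j 1" "?P [1, 2, 1, 2] = exc i k j 2"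
    "?P [1, 2, 1, 1] = exc j k i (f * h)" "?P [1, 1, 2, 2] = exc j k i (2 * f * h)"
    using assms(2) by (simp_all add: exc_def tri_def Z3_simps pt_swap(2)[of k j] pt_swap(1)[of j i "[k]"] pt_swap(2)[of k i])
  have "f = 1 \<or> f = 2" "h = 1 \<or> h = 2" by (simp_all flip: nonzero_Z3)
  then have "{f * h, 2 * f * h} = {1, 2}" by auto
  then have two: "exc j k i (f * h) \<and> exc j k i (2 * f * h) \<longleftrightarrow> exc j k i 1 \<and> exc j k i 2"
    by (metis insertCI insertE singletonD)
  have "?P [1, 1, 1, 2] \<and> ?P [1, 2, 2, 1] \<or> ?P [1, 1, 2, 1] \<and> ?P [1, 2, 1, 2] \<or> ?P [1, 2, 1, 1] \<and> ?P [1, 1, 2, 2]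
    \<or> ?P [1, 1, 1, 2] \<and> ?P [1, 1, 2, 1] \<and> ?P [1, 2, 1, 1] \<or> ?P [1, 2, 2, 1] \<and> ?P [1, 2, 1, 2] \<and> ?P [1, 1, 2, 2]"
    by (rule G.triangle_exceptional) (use assms(2) in \<open>simp_all add: pt_zero Z3_simps\<close>)
  moreover have "(1::3) \<noteq> 0" "(2::3) \<noteq> 0" by simp_all
  ultimately show ?thesis unfolding eq using two by blast
qed

text \<open>Equal triangle signs select the same point on \<open>i, j\<close>, which cannot be
  matched in two directions.\<close>

lemma exc_disjoint:
  assumes "{i, j, k, l} \<subseteq> K" "distinct [i, j, k, l]" "tri i j k = tri i j l" "a \<noteq> 0"
    and "exc i j k a" "exc i j l a"
  shows False
proof -
  have "alternating (sgn i j) i j"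
    using assms alternating_sgn clique_alt by auto
  note [simp] = alternatingD[OF this]
  have [simp]: "tri i j l \<noteq> 0" "sgn i k \<noteq> 0" "sgn i l \<noteq> 0"
    using sgn_nonzero clique_alt assms by (auto simp: tri_def)
  show False
    by (rule two_extensions[of "tri i j l" i j a "tri i j l * sgn i j * a" k "2 * tri i j l * sgn i k * a" l
          "2 * tri i j l * sgn i l * a"])
      (use assms clique_alt(2) in \<open>simp_all add: exc_def Z3_simps\<close>)
qed

lemma full_exc_not_adjacent:
  assumes "{i, j, k, l} \<subseteq> K" "distinct [i, j, k, l]" "tri i j k = tri i j l"
    and "exc i j k 1" "exc i j k 2" "exc i l j 1" "exc i l j 2"
  shows False
proof -
  define e f h p q where efh: "e = sgn i j" "f = sgn i k" "h = sgn j k" "p = sgn i l" "q = sgn j l"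
  have alts: "alternating e i j" "alternating f i k" "alternating h j k" "alternating p i l" "alternating q j l"
    unfolding efh using assms alternating_sgn clique_alt by auto
  note [simp] = alts[THEN alternatingD(1)] alts[THEN alternatingD(2)]
  have [simp]: "sgn i j = e" "sgn i k = f" "sgn j k = h" "sgn l j = q" "sgn i l = p" "sgn j l = q"
    unfolding efh using assms sgn_sym clique_alt by auto
  have "e * f * h = e * p * q" using assms(3) by (simp add: tri_def)
  \<comment> \<open>The common triangle sign determines the fifth pair sign, so four units suffice
    to normalise all five.\<close>
  then have q: "q = p * f * h" by (simp add: Z3_simps)
  let ?P = "rescaled g [i, j, k, l] [1, f * h, e * h, e * p * f * h] (e * f * h)"
  interpret G: grid 4 ?P
    using grid_rescaled[of "[i, j, k, l]" "[1, f * h, e * h, e * p * f * h]" "e * f * h"] assms clique_alt(2)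
    by (simp add: eval_nat_numeral)
  show False
    by (rule G.adjacent_sharing)
      (use assms(2,4-) in \<open>simp_all add: pt_zero Z3_simps exc_def tri_def q pt_swap(2)[of l j]\<close>)
qed

text \<open>If both points on \<open>i, j\<close> are matched in direction \<open>k\<close>, neither
  is matched in direction \<open>l\<close>. The triangle \<open>i, j, l\<close> must then have both
  points of \<open>i, l\<close> or of \<open>j, l\<close> matched, which
  \<open>full_exc_not_adjacent\<close> excludes, directly or with \<open>i\<close> and
  \<open>j\<close> exchanged.\<close>

lemma not_full_exc:
  assumes "{i, j, k, l} \<subseteq> K" "distinct [i, j, k, l]" "tri i j k = tri i j l"
  shows "\<not> (exc i j k 1 \<and> exc i j k 2)"
proof
  assume full: "exc i j k 1 \<and> exc i j k 2"
  have full_any: "exc i j k a" if "a \<noteq> 0" for a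
    using full that nonzero_Z3 by metis
  have full_swap: "exc j i k a" if "a \<noteq> 0" for a
  proof -
    let ?u = "tri i j k * sgn i j"
    have "?u \<noteq> 0"
      using sgn_nonzero clique_alt assms by (auto simp: tri_def)
    then have "exc j i k (?u * (?u * a))"
      using exc_swap[of i j k "?u * a"] full_any[of "?u * a"] assms that by simp
    then show ?thesis using \<open>?u \<noteq> 0\<close> by (simp only: square_left_Z3 not_False_eq_True)
  qed
  have no: "\<not> exc i j l a" if "a \<noteq> 0" for a
    using exc_disjoint[OF assms that] full_any[OF that] by blast
  have "\<not> (exc i l j 1 \<and> exc i l j 2)"
    using full_exc_not_adjacent[OF assms] full by blast
  moreover have "\<not> (exc j l i 1 \<and> exc j l i 2)"
    using full_exc_not_adjacent[of j i k l] full_swap[of 1] full_swap[of 2] assms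
      tri_sym[of i j k] tri_sym[of i j l] by auto
  ultimately show False
    using triangle_exc[of i j l] no assms by auto
qed

text \<open>When each pair lies in another triangle of the same sign, \<open>not_full_exc\<close>
  removes the first three cases of \<open>triangle_exc\<close>.\<close>

lemma common_exc:
  assumes "{i, j, k, l, l', l''} \<subseteq> K" "distinct [i, j, k]"
    and "l \<notin> {i, j, k}" "tri i j l = tri i j k" "l' \<notin> {i, j, k}" "tri i k l' = tri i j k"
    and "l'' \<notin> {i, j, k}" "tri j k l'' = tri i j k"
  shows "\<exists>a. a \<noteq> 0 \<and> exc i j k a \<and> exc i k j a"
proof -
  have "tri i k j = tri i j k" "tri j k i = tri i j k"
    using tri_sym[of i j k] assms by auto
  then show ?thesis
    using triangle_exc[of i j k] not_full_exc[of i j k l] not_full_exc[of i k j l'] not_full_exc[of j k i l'']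
      assms by auto
qed

text \<open>Each triangle at \<open>i\<close> provides a nonzero \<open>i\<close>-coordinate. Any
  two of them share a pair, so the three coordinates are distinct, but there are only two
  units.\<close>

lemma not_monochromatic:
  assumes ijkl: "{i, j, k, l} \<subseteq> K" "distinct [i, j, k, l]"
    and eq: "tri i j k = tri i j l" "tri i j l = tri i k l" "tri i k l = tri j k l"
  shows False
proof -
  define t where "t = tri i j k"
  have t: "tri i j k = t" "tri i j l = t" "tri i k l = t" "tri j k l = t"
    using eq by (simp_all add: t_def)
  have t': "tri i k j = t" "tri j k i = t" "tri i l j = t" "tri j l i = t" "tri i l k = t" "tri k l i = t"
    "tri j l k = t" "tri k l j = t"
    using tri_sym(2,3)[of i j k] tri_sym(2,3)[of i j l] tri_sym(2,3)[of i k l]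
      tri_sym(2,3)[of j k l] ijkl
    by (simp_all add: t)
  have ne: "i \<noteq> j" "i \<noteq> k" "i \<noteq> l" "j \<noteq> k" "j \<noteq> l" "k \<noteq> l" and mem: "i \<in> K" "j \<in> K" "k \<in> K" "l \<in> K"
    using ijkl by simp_all
  note facts = t t' mem ne ne[symmetric]
  obtain a1 where a1: "a1 \<noteq> 0" "exc i j k a1" "exc i k j a1"
    using common_exc[of i j k l l l] by (auto simp: facts)
  obtain a2 where a2: "a2 \<noteq> 0" "exc i j l a2" "exc i l j a2"
    using common_exc[of i j l k k k] by (auto simp: facts)
  obtain a3 where a3: "a3 \<noteq> 0" "exc i k l a3" "exc i l k a3"
    using common_exc[of i k l j j j] by (auto simp: facts)
  have "a1 \<noteq> a2" using exc_disjoint[of i j k l a1] a1 a2 by (auto simp: facts)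
  moreover have "a1 \<noteq> a3" using exc_disjoint[of i k j l a1] a1 a3 by (auto simp: facts)
  moreover have "a2 \<noteq> a3" using exc_disjoint[of i l j k a2] a2 a3 by (auto simp: facts)
  ultimately show False using a1(1) a2(1) a3(1) by (auto simp: nonzero_Z3)
qed

text \<open>In the product over the four triangles every pair sign occurs twice.\<close>

lemma tri_cocycle:
  assumes "{i, j, k, l} \<subseteq> K" "distinct [i, j, k, l]"
  shows "tri j k l = tri i j k * tri i j l * tri i k l" "tri i j k \<noteq> 0"
proof -
  have [simp]: "sgn i j \<noteq> 0" "sgn i k \<noteq> 0" "sgn i l \<noteq> 0" "sgn j k \<noteq> 0"
    using sgn_nonzero clique_alt assms by auto
  show "tri j k l = tri i j k * tri i j l * tri i k l" "tri i j k \<noteq> 0"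
    by (simp_all add: tri_def Z3_simps)
qed

text \<open>Suppose that all other triangles on \<open>i, j\<close> have sign \<open>2 * t\<close>.
  A triangle \<open>i, x, y\<close> of sign \<open>2 * t\<close> would, by the cocycle relation,
  make \<open>i, j, x, y\<close> monochromatic. So all of these have sign \<open>t\<close>, and then
  \<open>i, l, m, n\<close> is monochromatic.\<close>

lemma shared_pair:
  assumes "{i, j, k, l, m, n} \<subseteq> K" "distinct [i, j, k, l, m, n]"
  shows "\<exists>x\<in>{l, m, n}. tri i j x = tri i j k"
proof (rule ccontr)
  assume *: "\<not> (\<exists>x\<in>{l, m, n}. tri i j x = tri i j k)"
  define t where "t = tri i j k"
  have nz: "t \<noteq> 0" "tri i j l \<noteq> 0" "tri i j m \<noteq> 0" "tri i j n \<noteq> 0" "tri i l m \<noteq> 0" "tri i l n \<noteq> 0" "tri i m n \<noteq> 0"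
    unfolding t_def
    using tri_cocycle(2)[of i j k l] tri_cocycle(2)[of i j l k] tri_cocycle(2)[of i j m k] tri_cocycle(2)[of i j n k]
      tri_cocycle(2)[of i l m k] tri_cocycle(2)[of i l n k] tri_cocycle(2)[of i m n k] assms by auto
  have two: "x = 2 * t" if "x \<noteq> t" "x \<noteq> 0" for x
    using that nz(1) by (auto simp: nonzero_Z3)
  have other: "tri i j l = 2 * t" "tri i j m = 2 * t" "tri i j n = 2 * t"
    using * two nz by (auto simp: t_def)
  have t: "tri i x y = t" if "x \<in> {l, m, n}" "y \<in> {l, m, n}" "x \<noteq> y" for x y
  proof -
    have "tri i x y \<noteq> 0"
      using tri_cocycle(2)[of i x y k] assms that by auto
    moreover have "tri i x y \<noteq> 2 * t"
    proof
      assume "tri i x y = 2 * t"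
      moreover from this have "tri j x y = 2 * t"
        using tri_cocycle(1)[of i j x y] assms that other nz(1) by (auto simp: Z3_simps)
      ultimately show False
        using not_monochromatic[of i j x y] assms that other by auto
    qed
    ultimately show ?thesis using nz(1) by (auto simp: nonzero_Z3)
  qed
  have "tri l m n = t"
    using tri_cocycle(1)[of i l m n] t[of l m] t[of l n] t[of m n] assms nz(1) by (simp add: Z3_simps)
  then show False
    using not_monochromatic[of i l m n] t[of l m] t[of l n] t[of m n] assms by auto
qed

end

text \<open>Each of the four colours would be a perfect matching on five vertices.\<close>

lemma no_proper_edge_4_coloring_K5:
  assumes V: "distinct [p, q, r, s, t]" and C: "card C = 4"
    and sym: "\<And>x y. c x y = c y x"
    and col: "\<And>x y. \<lbrakk>x \<in> {p, q, r, s, t}; y \<in> {p, q, r, s, t}; x \<noteq> y\<rbrakk> \<Longrightarrow> c x y \<in> C"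
    and proper: "\<And>x y z. \<lbrakk>x \<in> {p, q, r, s, t}; y \<in> {p, q, r, s, t}; z \<in> {p, q, r, s, t}; x \<noteq> y; x \<noteq> z; y \<noteq> z\<rbrakk>
      \<Longrightarrow> c x y \<noteq> c x z"
  shows False
proof -
  have fin: "finite C" using C card.infinite by fastforce
  \<comment> \<open>The four edges at any vertex use all four colours.\<close>
  have all: "c p q \<in> c x ` ({p, q, r, s, t} - {x})" if x: "x \<in> {p, q, r, s, t}" for x
  proof -
    have "card ({p, q, r, s, t} - {x}) = 4" using V x by auto
    moreover have "inj_on (c x) ({p, q, r, s, t} - {x})"
      using proper x by (intro inj_onI) blast
    ultimately have "card (c x ` ({p, q, r, s, t} - {x})) = 4" by (simp add: card_image)
    moreover have "c x ` ({p, q, r, s, t} - {x}) \<subseteq> C" using col x by auto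
    ultimately have "c x ` ({p, q, r, s, t} - {x}) = C" using C fin by (simp add: card_subset_eq)
    then show ?thesis using col[of p q] V by simp
  qed
  have no: "c x p \<noteq> c p q" "c x q \<noteq> c p q" if "x \<in> {r, s, t}" for x
    using proper[of p x q] proper[of q x p] sym[of x p] sym[of x q] sym[of p q] that V by auto
  \<comment> \<open>The colour of \<open>p q\<close> would have to match the three remaining
    vertices among themselves.\<close>
  have "c p q = c r s \<or> c p q = c r t" using all[of r] no[of r] by auto
  moreover have "c p q = c s r \<or> c p q = c s t" using all[of s] no[of s] by auto
  moreover have "c p q = c t r \<or> c p q = c t s" using all[of t] no[of t] by auto
  ultimately show False
    using proper[of r s t] proper[of s r t] proper[of t r s] sym[of r s] sym[of r t] sym[of s t] V by auto
qed

lemma no_clique_6: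
  assumes K: "clique {u, p, q, r, s, t}" and dist: "distinct [u, p, q, r, s, t]"
  shows False
proof -
  let ?K = "{u, p, q, r, s, t}" and ?V = "{p, q, r, s, t}"
  define good where "good x y a \<longleftrightarrow> a \<noteq> 0 \<and> exc u x y a \<and> exc u y x a" for x y a
  \<comment> \<open>The colour is the sign of the triangle on \<open>u, x, y\<close> together with
    the common \<open>u\<close>-coordinate of matched points. The set of both orders makes
    \<open>c\<close> symmetric for all arguments.\<close>
  define c where "c x y = ({tri u x y, tri u y x}, SOME a. good x y a)" for x y
  have shared: "\<exists>l\<in>?K - {i, j, k}. tri i j l = tri i j k" if ijk: "{i, j, k} \<subseteq> ?K" "distinct [i, j, k]" for i j k
  proof -
    have "card (?K - {i, j, k}) = 3" using dist ijk by (subst card_Diff_subset) auto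
    then obtain l m n where lmn: "?K - {i, j, k} = {l, m, n}" "distinct [l, m, n]"
      by (auto simp: card_3_iff)
    then have "{l, m, n} \<inter> {i, j, k} = {}" "{l, m, n} \<subseteq> ?K" by blast+
    then show ?thesis
      using shared_pair[OF K, of i j k l m n] ijk lmn by auto
  qed
  have tri_sym': "tri u x y = tri u y x" if "x \<in> ?V" "y \<in> ?V" "x \<noteq> y" for x y
    using tri_sym(2)[OF K, of u y x] that dist by auto
  have ex: "\<exists>a. good x y a" if xy: "x \<in> ?V" "y \<in> ?V" "x \<noteq> y" for x y
  proof -
    have d: "{u, x, y} \<subseteq> ?K" "distinct [u, x, y]" using xy dist by auto
    obtain l1 where "l1 \<in> ?K - {u, x, y}" "tri u x l1 = tri u x y" using shared[of u x y] d by auto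
    moreover obtain l2 where "l2 \<in> ?K - {u, y, x}" "tri u y l2 = tri u y x" using shared[of u y x] d by auto
    moreover obtain l3 where "l3 \<in> ?K - {x, y, u}" "tri x y l3 = tri x y u" using shared[of x y u] d by auto
    ultimately show ?thesis
      using common_exc[OF K, of u x y l1 l2 l3] d tri_sym[OF K d] unfolding good_def by auto
  qed
  have some: "good x y (snd (c x y))" if "x \<in> ?V" "y \<in> ?V" "x \<noteq> y" for x y
    using someI_ex[OF ex[OF that]] by (simp add: c_def)
  show False
  proof (rule no_proper_edge_4_coloring_K5[of p q r s t "{{1}, {2}} \<times> {1, 2}" c])
    show "c x y = c y x" for x y
      by (simp add: c_def good_def insert_commute conj_commute)
    show "c x y \<in> {{1}, {2}} \<times> {1, 2}" if xy: "x \<in> ?V" "y \<in> ?V" "x \<noteq> y" for x y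
    proof -
      have "tri u x y \<noteq> 0"
        using sgn_nonzero clique_alt[OF K] xy dist by (auto simp: tri_def)
      moreover have "snd (c x y) \<noteq> 0" using some[OF xy] by (simp add: good_def)
      ultimately show ?thesis
        using tri_sym'[OF xy] by (auto simp: nonzero_Z3 c_def)
    qed
    show "c x y \<noteq> c x z" if "x \<in> ?V" "y \<in> ?V" "z \<in> ?V" "x \<noteq> y" "x \<noteq> z" "y \<noteq> z" for x y z
    proof
      assume eq: "c x y = c x z"
      then have "tri u x y = tri u x z"
        using tri_sym'[of x y] tri_sym'[of x z] that by (simp add: c_def)
      then show False
        using exc_disjoint[OF K, of u x y z "snd (c x y)"] some[of x y] some[of x z] eq that dist
        by (auto simp: good_def)
    qed
  qed (use dist in \<open>simp_all add: card_cartesian_product\<close>)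
qed


section \<open>A vertex cover of the alternating pairs\<close>

text \<open>The pendant vertex \<open>l\<close> is directed to \<open>j\<close> and
  \<open>k\<close>, hence is a source in the star at \<open>i\<close>.\<close>

lemma no_alt_paw:
  assumes "alt i j" "alt i k" "alt j k" "alt i l" "\<not> alt j l" "\<not> alt k l"
    and "{i, j, k, l} \<subseteq> J" "distinct [i, j, k, l]"
  shows False
  using alt_dominated[of j k l] no_alt_star_with_source[of i l j k] assms by auto

text \<open>The three leaves form a tournament without a directed cycle, so one of them is a
  source.\<close>

lemma no_alt_claw:
  assumes "alt c j" "alt c k" "alt c l" "\<not> alt j k" "\<not> alt j l" "\<not> alt k l"
    and "{c, j, k, l} \<subseteq> J" "distinct [c, j, k, l]"
  shows False
proof -
  have "dir j k \<or> dir k j" "dir j l \<or> dir l j" "dir k l \<or> dir l k"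
    using pair_cases[of j k] pair_cases[of j l] pair_cases[of k l] assms by auto
  then show False
    using no_alt_star_with_source[of c j k l] no_alt_star_with_source[of c k j l]
      no_alt_star_with_source[of c l j k] no_directed_cycle[of j k l] no_directed_cycle[of j l k] assms
    by auto
qed

text \<open>Both diagonals are directed, and their sources are adjacent on the square.\<close>

lemma no_alt_square:
  assumes "alt i j" "alt j k" "alt k l" "alt i l" "\<not> alt i k" "\<not> alt j l"
    and "{i, j, k, l} \<subseteq> J" "distinct [i, j, k, l]"
  shows False
proof -
  have "alt j i" "alt k j" "alt l k" "alt l i"
    using assms alt_sym by auto
  moreover have "dir i k \<or> dir k i" "dir j l \<or> dir l j"
    using pair_cases[of i k] pair_cases[of j l] assms by auto
  ultimately show False
    using no_alt_path_with_diagonals[of i j l k] no_alt_path_with_diagonals[of i l j k]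
      no_alt_path_with_diagonals[of k j l i] no_alt_path_with_diagonals[of k l j i] assms
    by auto
qed

text \<open>The pair \<open>j, k\<close> is left open, to cover both the path and two disjoint
  edges. Here \<open>l\<close> dominates the edge \<open>i j\<close> and \<open>i\<close> dominates
  the edge \<open>k l\<close>, so \<open>i\<close> and \<open>l\<close> are directed both
  ways.\<close>

lemma no_weakly_joined_edges:
  assumes "alt i j" "alt k l" "\<not> alt i k" "\<not> alt i l" "\<not> alt j l"
    and "{i, j, k, l} \<subseteq> J" "distinct [i, j, k, l]"
  shows False
  using alt_dominated(1)[of i j l] alt_dominated(2)[of k l i] dir_antisym[of i l] alt_sym[of k i] alt_sym[of l i]
    assms by auto

lemma card_clique_le: "clique K \<Longrightarrow> finite K \<Longrightarrow> card K \<le> 5"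
proof (rule ccontr)
  assume K: "clique K" "finite K" "\<not> card K \<le> 5"
  then obtain T where T: "T \<subseteq> K" "card T = 6" "finite T"
    using obtain_subset_with_card_n[of 6 K] by auto
  then obtain xs where xs: "set xs = T" "distinct xs"
    using finite_distinct_list by blast
  then have "length xs = 6" using T(2) xs distinct_card[of xs] by simp
  then obtain u p q r s t where "xs = [u, p, q, r, s, t]"
    by (auto simp: length_Suc_conv numeral_eq_Suc)
  moreover have "clique T" using K(1) T(1) by (auto simp: clique_def)
  ultimately show False using no_clique_6[of u p q r s t] xs by simp
qed

lemma exists_max_clique:
  assumes "finite J" "clique K"
  shows "\<exists>M. clique M \<and> (\<forall>L. clique L \<longrightarrow> card L \<le> card M)"
proof (rule ex_has_greatest_nat[where P = clique and b = "Suc (card J)"])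
  show "\<forall>L. clique L \<longrightarrow> card L < Suc (card J)"
    using assms(1) by (auto simp: clique_def less_Suc_eq_le intro: card_mono)
qed (fact assms(2))

text \<open>All alternating pairs lie in a maximum clique \<open>M\<close> together with at most one
  further vertex. Deleting from \<open>M\<close> a vertex not joined to the latter leaves a vertex
  cover.\<close>

lemma small_cover:
  assumes fin: "finite J"
  obtains S where "S \<subseteq> J" "card S \<le> 4" "\<And>i j. \<lbrakk>i \<in> J - S; j \<in> J - S; i \<noteq> j\<rbrakk> \<Longrightarrow> \<not> alt i j"
proof (cases "\<exists>i\<in>J. \<exists>j\<in>J. i \<noteq> j \<and> alt i j")
  case False
  then show thesis using that[of "{}"] by auto
next
  case True
  then obtain i0 j0 where ij0: "i0 \<in> J" "j0 \<in> J" "i0 \<noteq> j0" "alt i0 j0" by blast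
  then have "clique {i0, j0}" using alt_sym by (auto simp: clique_def)
  with exists_max_clique[OF fin this] obtain M
    where M: "clique M" "card {i0, j0} \<le> card M" and max: "\<And>L. clique L \<Longrightarrow> card L \<le> card M"
    by blast
  have M_alt: "alt x y" if "x \<in> M" "y \<in> M" "x \<noteq> y" for x y
    using M(1) that by (auto simp: clique_def)
  have MJ: "M \<subseteq> J" using M(1) by (simp add: clique_def)
  have finM: "finite M" using MJ fin by (rule finite_subset)
  have M5: "card M \<le> 5" using card_clique_le[OF M(1) finM] .
  have other: "\<exists>y\<in>M. y \<noteq> x" for x
  proof (rule ccontr)
    assume "\<not> (\<exists>y\<in>M. y \<noteq> x)"
    then have "M \<subseteq> {x}" by blast
    then have "card M \<le> 1" using card_mono[of "{x}" M] by simp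
    then show False using M(2) ij0(3) by simp
  qed
  define N where "N = {v \<in> J - M. \<exists>y\<in>M. alt v y}"
  have miss: "\<exists>x\<in>M. \<not> alt v x \<and> (\<forall>y\<in>M. y \<noteq> x \<longrightarrow> alt v y)" if v: "v \<in> N" for v
  proof -
    have v': "v \<in> J" "v \<notin> M" using v by (auto simp: N_def)
    obtain y where y: "y \<in> M" "alt v y" using v by (auto simp: N_def)
    have "\<not> clique (insert v M)"
      using max[of "insert v M"] v' finM by auto
    then obtain x where x: "x \<in> M" "\<not> alt v x"
      using M(1) v' MJ alt_sym by (force simp: clique_def)
    \<comment> \<open>If \<open>v\<close> also missed \<open>z\<close>, the triangle
      \<open>x, y, z\<close> with \<open>v\<close> attached at \<open>y\<close> would be a
      paw.\<close>
    have "alt v z" if z: "z \<in> M" "z \<noteq> x" for z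
    proof (rule ccontr)
      assume nz: "\<not> alt v z"
      have d: "distinct [y, x, z, v]" using x y z nz v' by auto
      then have "\<not> alt x v" "\<not> alt z v" "alt y v"
        using x y z nz alt_sym[of x v] alt_sym[of z v] alt_sym[of v y] by auto
      then show False
        using no_alt_paw[of y x z v] M_alt[of y x] M_alt[of y z] M_alt[of x z] d x y z v' MJ by auto
    qed
    with x show ?thesis by blast
  qed
  have N_unique: "v = v'" if v: "v \<in> N" and v': "v' \<in> N" for v v'
  proof (rule ccontr)
    assume ne: "v \<noteq> v'"
    have J: "v \<in> J" "v' \<in> J" "v \<notin> M" "v' \<notin> M" using v v' by (auto simp: N_def)
    obtain x where x: "x \<in> M" "\<not> alt v x" "\<And>y. \<lbrakk>y \<in> M; y \<noteq> x\<rbrakk> \<Longrightarrow> alt v y" using miss[OF v] by blast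
    obtain x' where x': "x' \<in> M" "\<not> alt v' x'" "\<And>y. \<lbrakk>y \<in> M; y \<noteq> x'\<rbrakk> \<Longrightarrow> alt v' y" using miss[OF v'] by blast
    \<comment> \<open>If both miss the same vertex, a paw or claw arises at another vertex of
      \<open>M\<close>; otherwise \<open>v, x', x, v'\<close> is a square or a path.\<close>
    show False
    proof (cases "x = x'")
      case True
      obtain y where y: "y \<in> M" "y \<noteq> x" using other by blast
      have d: "distinct [y, v, v', x]" using J x(1) y ne by auto
      have "alt y v" "alt y v'" "alt y x" "\<not> alt v x" "\<not> alt v' x" "\<not> alt x v" "\<not> alt x v'"
        using x x' y True d M_alt[of y x] alt_sym[of v y] alt_sym[of v' y] alt_sym[of x v] alt_sym[of x v']
        by auto
      then show False
        using no_alt_paw[of y v v' x] no_alt_claw[of y v v' x] d J x(1) y MJ by auto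
    next
      case False
      have d: "distinct [v, x', x, v']" using J x(1) x'(1) ne False by auto
      have "alt v x'" "alt x' x" "alt x v'" "\<not> alt v x" "\<not> alt x' v'"
        using x x' False d M_alt[of x' x] alt_sym[of v' x] alt_sym[of x' v'] by auto
      then show False
        using no_alt_square[of v x' x v'] no_weakly_joined_edges[of v x' x v'] d J x(1) x'(1) MJ by auto
    qed
  qed
  \<comment> \<open>With \<open>p\<close> joined to nothing in \<open>M\<close>, two vertices of
    \<open>M\<close> form a paw with \<open>p, q\<close> if \<open>q\<close> is joined to both, and
    two weakly joined edges otherwise.\<close>
  have near: "p \<in> M \<union> N" if p: "p \<in> J" "q \<in> J" "p \<noteq> q" "alt p q" for p q
  proof (rule ccontr)
    assume np: "p \<notin> M \<union> N"
    then have pM: "\<not> alt p y" if "y \<in> M" for y using that p(1) by (auto simp: N_def)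
    then have qM: "q \<notin> M" using p by blast
    obtain m1 where m1: "m1 \<in> M" using other by blast
    obtain m2 where m2: "m2 \<in> M" "m2 \<noteq> m1" using other by blast
    have d: "distinct [q, m1, m2, p]" "distinct [p, q, m1, m2]" "distinct [p, q, m2, m1]"
      using np qM m1 m2 p(3) by auto
    have "alt m1 m2" "alt m2 m1" "alt q p" "\<not> alt m1 p" "\<not> alt m2 p"
      using M_alt m1 m2 alt_sym[of p q] alt_sym[of m1 p] alt_sym[of m2 p] p pM np by auto
    then show False
      using no_alt_paw[of q m1 m2 p] no_weakly_joined_edges[of p q m1 m2] no_weakly_joined_edges[of p q m2 m1]
        d p pM m1 m2 MJ by auto
  qed
  obtain x where x: "x \<in> M" "\<And>v. v \<in> N \<Longrightarrow> \<not> alt v x"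
  proof (cases "N = {}")
    case True
    then show thesis using that other by blast
  next
    case False
    then obtain v where "v \<in> N" by blast
    then show thesis using that miss N_unique by metis
  qed
  show thesis
  proof (rule that[of "M - {x}"])
    show "M - {x} \<subseteq> J" using MJ by blast
    show "card (M - {x}) \<le> 4" using M5 x(1) finM by simp
    fix i j assume ij: "i \<in> J - (M - {x})" "j \<in> J - (M - {x})" "i \<noteq> j"
    show "\<not> alt i j"
    proof
      assume a: "alt i j"
      then have "alt j i" using alt_sym ij by blast
      then have "i \<in> insert x N" "j \<in> insert x N" using near[of i j] near[of j i] a ij by auto
      then show False using x(2) N_unique a \<open>alt j i\<close> ij(3) by (metis insertE)
    qed
  qed
qed
section \<open>Values in the absence of alternating pairs\<close>

lemma weight1:
  assumes "m \<in> J" "a \<noteq> 0"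
  shows "g ((\<lambda>_. 0)(m := a)) = {0}"
proof -
  have "1 \<notin> g ((\<lambda>_. 0)(m := a))" "2 \<notin> g ((\<lambda>_. 0)(m := a))"
    using vertical[of 1 "\<lambda>_. 0" 2 m a] vertical[of 2 "\<lambda>_. 0" 1 m a] assms by (simp_all add: origin)
  moreover have "x = 0" if "x \<in> g ((\<lambda>_. 0)(m := a))" for x
    using that calculation exhaust_Z3[of x] by auto
  ultimately show ?thesis using nonempty[of "(\<lambda>_. 0)(m := a)"] by blast
qed

context
  fixes I
  assumes IJ: "I \<subseteq> J" and no_alt: "\<And>i j. \<lbrakk>i \<in> I; j \<in> I; i \<noteq> j\<rbrakk> \<Longrightarrow> \<not> alt i j"
begin

lemma dir_trans:
  assumes "dir i j" "dir j k" "{i, j, k} \<subseteq> I" "distinct [i, j, k]"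
  shows "dir i k"
  using pair_cases[of i k] no_alt[of i k] no_directed_cycle[of i j k] assms IJ by auto

lemma exists_sink:
  "\<lbrakk>finite S; S \<noteq> {}; S \<subseteq> I\<rbrakk> \<Longrightarrow> \<exists>m\<in>S. \<forall>i\<in>S - {m}. dir i m"
proof (induction rule: finite_ne_induct)
  case (insert x F)
  then obtain m where m: "m \<in> F" "\<forall>i\<in>F - {m}. dir i m" by auto
  have xm: "x \<noteq> m" "x \<in> I" "m \<in> I" using insert m(1) by auto
  then consider "dir x m" | "dir m x"
    using pair_cases[of x m] no_alt[of x m] IJ by blast
  then show ?case
  proof cases
    case 1
    then show ?thesis using m by (intro bexI[of _ m]) auto
  next
    case 2
    have "dir i x" if "i \<in> F" for i
      using dir_trans[of i m x] m 2 xm insert that by (cases "i = m") auto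
    then show ?thesis by (intro bexI[of _ x]) auto
  qed
qed simp

text \<open>The common sign of the pairs directed out of \<open>i\<close>. If there are none, the
  default 1 keeps the coefficient a unit.\<close>

definition weight :: "nat \<Rightarrow> 3" where
  "weight i = (if \<exists>j\<in>I - {i}. dir i j then SOME s. \<exists>j\<in>I - {i}. directed s i j else 1)"

lemma directed_weight:
  assumes "dir i j" "i \<in> I" "j \<in> I" "i \<noteq> j"
  shows "directed (weight i) i j"
proof -
  obtain s where s: "directed s i j" using assms by (auto simp: dir_def)
  have unique: "t = s" if "directed t i k" "k \<in> I - {i}" for t k
    using that directed_unique[OF s] directed_same_sign[OF s that(1)] assms IJ by (cases "j = k") auto
  have "(SOME s. \<exists>j\<in>I - {i}. directed s i j) = s"
  proof (rule some_equality)
    show "\<exists>j\<in>I - {i}. directed s i j" using s assms by blast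
  qed (use unique in blast)
  moreover have "\<exists>j\<in>I - {i}. dir i j" using assms by blast
  ultimately have "weight i = s" by (simp add: weight_def)
  with s show ?thesis by simp
qed

lemma weight_nonzero:
  assumes "i \<in> I"
  shows "weight i \<noteq> 0"
proof (cases "\<exists>j\<in>I - {i}. dir i j")
  case True
  then obtain j where "j \<in> I" "i \<noteq> j" "dir i j" by auto
  then show ?thesis using directed_weight[of i j] directedD(1)[of "weight i" i j] assms by blast
qed (simp add: weight_def)

text \<open>The value at a point does not depend on the coordinate that comes last in the order
  \<^const>\<open>dir\<close>, so that a point and its neighbour in this coordinate are matched.\<close>

lemma value_formula:
  assumes "finite {i. x i \<noteq> 0}" "{i. x i \<noteq> 0} \<subseteq> I" "x m \<noteq> 0" "\<And>i. \<lbrakk>x i \<noteq> 0; i \<noteq> m\<rbrakk> \<Longrightarrow> dir i m"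
  shows "g x = {\<Sum>i\<in>{i. x i \<noteq> 0} - {m}. weight i * x i}"
  using assms
proof (induction "card {i. x i \<noteq> 0}" arbitrary: x rule: less_induct)
  case less
  let ?T = "\<lambda>x. {i. x i \<noteq> 0} - {m}" and ?s = "\<lambda>x. \<Sum>i\<in>{i. x i \<noteq> 0} - {m}. weight i * (x i :: 3)"
  define S where "S = {i. x i \<noteq> 0}"
  have mI: "m \<in> I" and mJ: "m \<in> J" using less.prems IJ by auto
  have "card S \<noteq> 0" using less.prems by (auto simp: S_def)
  then consider (one) "card S = 1" | (two) "card S = 2" | (many) "card S \<ge> 3" by linarith
  then show ?case
  proof cases
    case one
    moreover have "m \<in> S" using less.prems(3) by (simp add: S_def)
    ultimately have S: "S = {m}" by (auto simp: card_1_singleton_iff)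
    then have "x = (\<lambda>_. 0)(m := x m)" by (auto simp: S_def fun_eq_iff)
    then have "g x = {0}" using weight1[OF mJ less.prems(3)] by simp
    then show ?thesis using S by (simp add: S_def)
  next
    case two
    then obtain p q where "S = {p, q}" "p \<noteq> q" by (auto simp: card_2_iff)
    moreover have "m \<in> S" using less.prems(3) by (simp add: S_def)
    ultimately obtain i where i: "i \<noteq> m" "S = {i, m}" by (metis insertE insert_commute singletonD)
    then have xi: "x i \<noteq> 0" "i \<in> I" using less.prems by (auto simp: S_def)
    have "x = pt [i, m] [x i, x m]" using i by (auto simp: S_def fun_eq_iff pt_Cons)
    moreover have "directed (weight i) i m"
      using less.prems(4)[OF xi(1) i(1)] xi(2) mI i(1) by (rule directed_weight)
    then have "g (pt [i, m] [x i, x m]) = {weight i * x i}"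
      by (rule directedD(2)[OF _ xi(1) less.prems(3)])
    ultimately have "g x = {weight i * x i}" by simp
    moreover have "{i. x i \<noteq> 0} - {m} = {i}" using i by (auto simp: S_def)
    ultimately show ?thesis by simp
  next
    case many
    \<comment> \<open>By induction, deleting coordinate \<open>j\<close> gives a point
      \<open>z\<close> with this value, shared with its neighbour \<open>z'\<close> in direction
      \<open>m\<close>; hence the neighbour \<open>y\<close> of \<open>z\<close> cannot have
      it.\<close>
    have excl: "?s y - weight j * y j \<notin> g y"
      if supp: "{i. y i \<noteq> 0} = S" and j: "j \<in> S" "j \<noteq> m" for y j
    proof -
      define z where "z = y(j := 0)"
      define z' where "z' = z(m := 2 * z m)"
      have suppz: "{i. z i \<noteq> 0} = S - {j}" "{i. z' i \<noteq> 0} = S - {j}"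
        using supp j by (auto simp: z_def z'_def split: if_splits)
      have S: "finite S" "S \<subseteq> I" "m \<in> S" using less.prems by (auto simp: S_def)
      have less': "card (S - {j}) < card {i. x i \<noteq> 0}"
        unfolding S_def[symmetric] using S(1) j(1) by (intro psubset_card_mono) auto
      have sums: "?s z = ?s y - weight j * y j" "?s z' = ?s z"
      proof -
        have "?s y = weight j * y j + (\<Sum>i\<in>S - {m} - {j}. weight i * y i)"
          unfolding supp using S(1) j by (intro sum.remove) auto
        moreover have "(\<Sum>i\<in>S - {m} - {j}. weight i * y i) = ?s z"
          unfolding suppz by (intro sum.cong) (auto simp: z_def)
        ultimately show "?s z = ?s y - weight j * y j" by simp
        show "?s z' = ?s z" unfolding suppz by (intro sum.cong) (auto simp: z'_def)
      qed
      have dir_m: "dir i m" if "i \<in> S - {j}" "i \<noteq> m" for i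
        using less.prems(4)[of i] that by (simp add: S_def)
      have ym: "y m \<noteq> 0" using supp S(3) by blast
      have hyp: "g u = {?s u}" if u: "{i. u i \<noteq> 0} = S - {j}" for u
      proof (rule less.hyps)
        show "card {i. u i \<noteq> 0} < card {i. x i \<noteq> 0}" using less' u by simp
        show "finite {i. u i \<noteq> 0}" "{i. u i \<noteq> 0} \<subseteq> I" using S u by auto
        have "m \<in> {i. u i \<noteq> 0}" using u S(3) j(2) by simp
        then show "u m \<noteq> 0" by simp
        show "dir i m" if "u i \<noteq> 0" "i \<noteq> m" for i
        proof -
          have "i \<in> {i. u i \<noteq> 0}" using that(1) by simp
          then show ?thesis using dir_m that(2) unfolding u by blast
        qed
      qed
      have "g z = {?s z}" "g z' = {?s z'}"
        using hyp suppz by blast+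
      then have in_z: "?s y - weight j * y j \<in> g z" "?s y - weight j * y j \<in> g z'"
        by (simp_all add: sums)
      show ?thesis
      proof
        assume in_y: "?s y - weight j * y j \<in> g y"
        have yj: "y j \<noteq> 0" "y m \<noteq> 0" using supp j ym by blast+
        have "z(j := y j) = y" by (simp add: z_def)
        then have "z(m := 2 * z m) = z(j := y j)"
          using horizontal[of "?s y - weight j * y j" z m "2 * z m" j "y j"] in_y in_z yj j S IJ mJ
          by (auto simp: z_def z'_def)
        from fun_cong[OF this, of m] show False using j(2) yj by (simp add: z_def)
      qed
    qed
    \<comment> \<open>Two distinct nonzero contributions exclude two of the three elements.\<close>
    have mixed: "g y = {?s y}"
      if supp: "{i. y i \<noteq> 0} = S" and j: "j \<in> S" "j \<noteq> m" and k: "k \<in> S" "k \<noteq> m"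
        and ne: "weight j * y j \<noteq> weight k * y k" for y j k
    proof -
      have nz: "weight j * y j \<noteq> 0" "weight k * y k \<noteq> 0"
        using supp j k weight_nonzero less.prems(2) by (auto simp: S_def)
      have "c = ?s y" if c: "c \<in> g y" for c
      proof -
        have "?s y - c \<noteq> weight j * y j" "?s y - c \<noteq> weight k * y k"
          using excl[OF supp j] excl[OF supp k] c by (auto simp: algebra_simps)
        then have "?s y - c = 0" by (rule eq_0_Z3[OF nz ne])
        then show ?thesis by simp
      qed
      then show ?thesis using nonempty[of y] by blast
    qed
    have supp: "{i. x i \<noteq> 0} = S" by (simp add: S_def)
    have fin: "finite S" using less.prems by (simp add: S_def)
    have "card (S - {m}) \<ge> 2" using many fin less.prems(3) by (simp add: S_def)
    then obtain T where "T \<subseteq> S - {m}" "card T = 2" by (rule obtain_subset_with_card_n)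
    then obtain j k where jk: "j \<in> S" "j \<noteq> m" "k \<in> S" "k \<noteq> m" "j \<noteq> k"
      by (auto simp: card_2_iff)
    show ?thesis
    proof (cases "weight j * x j = weight k * x k")
      case False
      then show ?thesis using mixed[OF supp jk(1-4)] by simp
    next
      case True
      \<comment> \<open>For equal contributions \<open>t\<close>, only \<open>?s x - t\<close> is
        excluded so far. Negating coordinate \<open>j\<close> gives a mixed point \<open>y\<close>
        that shares \<open>?s x + t\<close> with its neighbour in direction \<open>m\<close>, which
        excludes this element over \<open>x\<close> too.\<close>
      define t where "t = weight j * x j"
      define y where "y = x(j := 2 * x j)"
      define y' where "y' = y(m := 2 * y m)"
      have nz: "x j \<noteq> 0" "x m \<noteq> 0" "t \<noteq> 0" "j \<in> J"
        using jk less.prems weight_nonzero IJ by (auto simp: S_def t_def)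
      have suppy: "{i. y i \<noteq> 0} = S" "{i. y' i \<noteq> 0} = S"
        using jk by (auto simp: y_def y'_def S_def split: if_splits)
      have sums: "?s y = ?s x + t" "?s y' = ?s y"
      proof -
        have "?s x = weight j * x j + (\<Sum>i\<in>S - {m} - {j}. weight i * x i)"
          unfolding supp using fin jk by (intro sum.remove) auto
        moreover have "?s y = weight j * y j + (\<Sum>i\<in>S - {m} - {j}. weight i * y i)"
          unfolding suppy using fin jk by (intro sum.remove) auto
        moreover have "(\<Sum>i\<in>S - {m} - {j}. weight i * y i) = (\<Sum>i\<in>S - {m} - {j}. weight i * x i)"
          by (intro sum.cong) (auto simp: y_def)
        ultimately show "?s y = ?s x + t" by (simp add: y_def t_def)
        show "?s y' = ?s y" unfolding suppy by (intro sum.cong) (auto simp: y'_def)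
      qed
      have ne: "weight j * y j \<noteq> weight k * y k" "weight j * y' j \<noteq> weight k * y' k"
        using True jk nz by (auto simp: y_def y'_def t_def mult.left_commute)
      have "g y = {?s x + t}" "g y' = {?s x + t}"
        using mixed[OF suppy(1) jk(1-4) ne(1)] mixed[OF suppy(2) jk(1-4) ne(2)] by (simp_all add: sums)
      then have in_y: "?s x + t \<in> g y" "?s x + t \<in> g (y(m := 2 * y m))"
        by (simp_all add: y'_def)
      have plus: "?s x + t \<notin> g x"
      proof
        assume in_x: "?s x + t \<in> g x"
        have "y(j := x j) = x" by (simp add: y_def)
        then have "y(m := 2 * y m) = y(j := x j)"
          using horizontal[OF in_y(1) in_y(2), of j "x j"] in_x mJ nz jk by (auto simp: y_def)
        from fun_cong[OF this, of m] show False using jk nz by (simp add: y_def)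
      qed
      have "c = ?s x" if c: "c \<in> g x" for c
      proof -
        have "?s x - c \<noteq> t" "?s x - c \<noteq> 2 * t"
          using excl[OF supp jk(1,2)] plus c by (auto simp: t_def algebra_simps)
        then have "?s x - c = 0" using nz(3) by (intro eq_0_Z3[of t "2 * t"]) simp_all
        then show ?thesis by simp
      qed
      then show ?thesis using nonempty[of x] by blast
    qed
  qed
qed

text \<open>The form differs from the value by the nonzero term of the last coordinate; at the
  origin it is 0, and the fibre is \<open>{1, 2}\<close>.\<close>

lemma linear_form_avoids:
  assumes "finite I" "\<And>i. i \<notin> I \<Longrightarrow> x i = 0"
  shows "(\<Sum>i\<in>I. weight i * x i) \<notin> g x"
proof -
  let ?S = "{i. x i \<noteq> 0}"
  have SI: "?S \<subseteq> I" using assms(2) by blast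
  then have fin: "finite ?S" using assms(1) by (rule finite_subset)
  have sum: "(\<Sum>i\<in>I. weight i * x i) = (\<Sum>i\<in>?S. weight i * x i)"
    using assms(1) SI by (intro sum.mono_neutral_right) auto
  show ?thesis
  proof (cases "?S = {}")
    case True
    then have "x = (\<lambda>_. 0)" by auto
    then show ?thesis by (simp add: origin)
  next
    case False
    then obtain m where m: "x m \<noteq> 0" "\<And>i. \<lbrakk>x i \<noteq> 0; i \<noteq> m\<rbrakk> \<Longrightarrow> dir i m"
      using exists_sink[OF fin False SI] by auto
    have "g x = {\<Sum>i\<in>?S - {m}. weight i * x i}" using fin SI m by (rule value_formula)
    moreover have "(\<Sum>i\<in>?S. weight i * x i) = weight m * x m + (\<Sum>i\<in>?S - {m}. weight i * x i)"
      using fin m(1) by (intro sum.remove) auto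
    moreover have "weight m * x m \<noteq> 0" using m(1) SI weight_nonzero by auto
    ultimately show ?thesis by (simp add: sum)
  qed
qed

end

theorem exists_avoiding_linear_form:
  assumes "finite J"
  obtains I w where "I \<subseteq> J" "card J \<le> card I + 4" "\<And>i. i \<in> I \<Longrightarrow> w i \<noteq> 0"
    "\<And>x. (\<And>i. i \<notin> I \<Longrightarrow> x i = 0) \<Longrightarrow> (\<Sum>i\<in>I. w i * x i) \<notin> g x"
proof -
  obtain S where S: "S \<subseteq> J" "card S \<le> 4"
    "\<And>i j. \<lbrakk>i \<in> J - S; j \<in> J - S; i \<noteq> j\<rbrakk> \<Longrightarrow> \<not> alt i j"
    using small_cover[OF assms] by blast
  show thesis
  proof (rule that[of "J - S" "weight (J - S)"])
    show "card J \<le> card (J - S) + 4"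
      using S assms by (simp add: card_Diff_subset finite_subset)
    show "weight (J - S) i \<noteq> 0" if "i \<in> J - S" for i
      using weight_nonzero[of "J - S"] S(3) that by blast
    show "(\<Sum>i\<in>J - S. weight (J - S) i * x i) \<notin> g x" if "\<And>i. i \<notin> J - S \<Longrightarrow> x i = 0" for x
      using linear_form_avoids[of "J - S" x] S(3) assms that by auto
  qed blast
qed

end

section \<open>Canonical restrictions\<close>

lemma card_Z3_vecs: "finite J \<Longrightarrow> card (Z3_vecs J) = 3 ^ card J"
  by (simp add: Z3_vecs_def card_PiE)

lemma finite_Z3_vecs: "finite J \<Longrightarrow> finite (Z3_vecs J)"
  by (simp add: Z3_vecs_def finite_PiE)

lemma hamming_adjI:
  assumes "x \<in> Z3_vecs J" "y \<in> Z3_vecs J" "i \<in> J" "x i \<noteq> y i" "\<And>j. \<lbrakk>j \<in> J; j \<noteq> i\<rbrakk> \<Longrightarrow> x j = y j"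
  shows "hamming_adj J x y"
proof -
  have "{j \<in> J. x j \<noteq> y j} = {i}" using assms(3-5) by auto
  then show ?thesis using assms(1,2) by (simp add: hamming_adj_def)
qed

lemma hamming_adjE:
  assumes "hamming_adj J x y"
  obtains i where "i \<in> J" "x i \<noteq> y i" "\<And>j. \<lbrakk>j \<in> J; j \<noteq> i\<rbrakk> \<Longrightarrow> x j = y j"
proof -
  obtain i where i: "{j \<in> J. x j \<noteq> y j} = {i}"
    using assms unfolding hamming_adj_def by (auto simp: card_1_singleton_iff)
  then have "i \<in> J \<and> x i \<noteq> y i" "\<And>j. \<lbrakk>j \<in> J; j \<noteq> i\<rbrakk> \<Longrightarrow> x j = y j" by blast+
  then show thesis using that by blast
qed

lemma induced_max_degree_le1D:
  assumes "finite V" "induced_max_degree adj V \<le> 1"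
    and "v \<in> V" "w \<in> V" "w' \<in> V" "adj v w" "adj v w'"
  shows "w = w'"
proof -
  have "card {w \<in> V. adj v w} \<le> (SUP v\<in>V. card {w \<in> V. adj v w})"
    using assms(1,3) by (intro cSUP_upper) auto
  then have "card {w \<in> V. adj v w} \<le> 1"
    using assms(2) by (simp add: induced_max_degree_def)
  then show ?thesis
    using assms(1,4-) card_le_Suc0_iff_eq[of "{w \<in> V. adj v w}"] by auto
qed

lemma induced_max_degree_le1I:
  assumes "finite V" "V \<noteq> {}"
    and "\<And>v w w'. \<lbrakk>v \<in> V; w \<in> V; w' \<in> V; adj v w; adj v w'\<rbrakk> \<Longrightarrow> w = w'"
  shows "induced_max_degree adj V \<le> 1"
  unfolding induced_max_degree_def
proof (rule cSUP_least[OF assms(2)])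
  fix v assume "v \<in> V"
  then show "card {w \<in> V. adj v w} \<le> 1"
    using assms(1,3) card_le_Suc0_iff_eq[of "{w \<in> V. adj v w}"] by auto
qed

text \<open>An independent set meets each line in direction 0 at most once, so forgetting coordinate
  0 is injective on it.\<close>

lemma card_hamming_independent_le:
  assumes "finite I" "0 \<notin> I" "hamming_independent (insert 0 I) T"
  shows "card T \<le> 3 ^ card I"
proof -
  have T: "T \<subseteq> Z3_vecs (insert 0 I)" "\<And>x y. \<lbrakk>x \<in> T; y \<in> T\<rbrakk> \<Longrightarrow> \<not> hamming_adj (insert 0 I) x y"
    using assms(3) by (auto simp: hamming_independent_def)
  have "inj_on (\<lambda>x. restrict x I) T"
  proof (rule inj_onI, rule ccontr)
    fix x y assume xy: "x \<in> T" "y \<in> T" "restrict x I = restrict y I" "x \<noteq> y"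
    have eq: "x i = y i" if "i \<in> I" for i
      using fun_cong[OF xy(3), of i] that by simp
    have mem: "x \<in> Z3_vecs (insert 0 I)" "y \<in> Z3_vecs (insert 0 I)" using xy T(1) by auto
    have "x 0 \<noteq> y 0"
    proof
      assume "x 0 = y 0"
      then have "x = y"
        using mem eq by (intro PiE_ext[of x "insert 0 I" "\<lambda>_. UNIV"]) (auto simp: Z3_vecs_def)
      then show False using xy(4) by simp
    qed
    then have "hamming_adj (insert 0 I) x y"
      using mem eq by (intro hamming_adjI[of _ _ _ 0]) auto
    then show False using T(2) xy by blast
  qed
  moreover have "(\<lambda>x. restrict x I) ` T \<subseteq> Z3_vecs I"
    by (auto simp: Z3_vecs_def)
  ultimately have "card T \<le> card (Z3_vecs I)"
    using finite_Z3_vecs[OF assms(1)] by (rule card_inj_on_le)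
  then show ?thesis using card_Z3_vecs[OF assms(1)] by simp
qed

text \<open>As all coefficients are units, no two points of the graph differ in exactly one
  coordinate; its size attains the bound.\<close>

lemma affine_max_independent:
  assumes I: "finite I" "0 \<notin> I" and w: "\<And>i. i \<in> I \<Longrightarrow> w i \<noteq> 0"
  shows "hamming_max_independent (insert 0 I) {z \<in> Z3_vecs (insert 0 I). z 0 = (\<Sum>i\<in>I. w i * z i)}"
    (is "hamming_max_independent _ ?S")
proof -
  have "\<not> hamming_adj (insert 0 I) x y" if "x \<in> ?S" "y \<in> ?S" for x y
  proof
    assume "hamming_adj (insert 0 I) x y"
    then obtain k where k: "k \<in> insert 0 I" "x k \<noteq> y k"
      "\<And>j. \<lbrakk>j \<in> insert 0 I; j \<noteq> k\<rbrakk> \<Longrightarrow> x j = y j" by (rule hamming_adjE) blast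
    show False
    proof (cases "k = 0")
      case True
      have "x j = y j" if "j \<in> I" for j
        using k(3)[of j] that True I(2) by (cases "j = 0") auto
      then have "(\<Sum>i\<in>I. w i * x i) = (\<Sum>i\<in>I. w i * y i)" by simp
      then show False using that k(2) True by simp
    next
      case False
      then have kI: "k \<in> I" "x 0 = y 0" using k by auto
      have "(\<Sum>i\<in>I - {k}. w i * x i) = (\<Sum>i\<in>I - {k}. w i * y i)"
        using k(3) by (intro sum.cong) auto
      then have "w k * x k = w k * y k"
        using that kI I(1) by (simp add: sum.remove[of I k])
      then show False using w[OF kI(1)] k(2) by (simp add: mult_left_cancel_Z3)
    qed
  qed
  then have indep: "hamming_independent (insert 0 I) ?S"
    by (auto simp: hamming_independent_def)
  let ?f = "\<lambda>z. z(0 := \<Sum>i\<in>I. w i * z i)"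
  have "inj_on ?f (Z3_vecs I)"
  proof (rule inj_onI)
    fix x y assume xy: "x \<in> Z3_vecs I" "y \<in> Z3_vecs I" "?f x = ?f y"
    have "x i = y i" if "i \<in> I" for i
      using fun_cong[OF xy(3), of i] that I(2) by (auto split: if_splits)
    then show "x = y" using xy(1,2) by (intro PiE_ext[of x I "\<lambda>_. UNIV"]) (auto simp: Z3_vecs_def)
  qed
  moreover have "?f ` Z3_vecs I \<subseteq> ?S"
  proof
    fix u assume "u \<in> ?f ` Z3_vecs I"
    then obtain z where z: "z \<in> Z3_vecs I" "u = ?f z" by blast
    have "(\<Sum>i\<in>I. w i * u i) = (\<Sum>i\<in>I. w i * z i)"
      using z(2) I(2) by (intro sum.cong) auto
    moreover have "u \<in> Z3_vecs (insert 0 I)"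
      using z by (auto simp: Z3_vecs_def PiE_iff extensional_def)
    ultimately show "u \<in> ?S" using z(2) by simp
  qed
  moreover have "finite ?S" using finite_Z3_vecs[of "insert 0 I"] I(1) by simp
  ultimately have "card (Z3_vecs I) \<le> card ?S" by (rule card_inj_on_le)
  then have "3 ^ card I \<le> card ?S" using card_Z3_vecs[OF I(1)] by simp
  then show ?thesis
    unfolding hamming_max_independent_def
    using indep le_trans[OF card_hamming_independent_le[OF I]] by simp
qed

section \<open>From the given set to its fibres and back\<close>

locale fibred_induced_degree1 =
  fixes n :: nat and Uf :: "(nat \<Rightarrow> 3) \<Rightarrow> 3 set"
  assumes in_range: "Uf \<in> Z3_vecs {1..n} \<rightarrow> {val_A, val_B, val_C, val_X, val_Y, val_Z}"
    and degree1: "has_induced_degree_1 n Uf"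
    and zero: "Uf (zero_vec n) = val_X"
begin

abbreviation U :: "(nat \<Rightarrow> 3) set" where "U \<equiv> corresponding_set n Uf"

text \<open>Points become total functions whose coordinates outside \<open>{1..n}\<close> are
  ignored, as \<open>degree1_section\<close> requires.\<close>

definition g :: "(nat \<Rightarrow> 3) \<Rightarrow> 3 set" where "g x = Uf (restrict x {1..n})"

definition lift :: "3 \<Rightarrow> (nat \<Rightarrow> 3) \<Rightarrow> nat \<Rightarrow> 3" where "lift c x = (restrict x {1..n})(0 := c)"

lemma restrict_Z3_vecs [simp]: "restrict x J \<in> Z3_vecs J"
  by (simp add: Z3_vecs_def)

lemma lift_Z3_vecs [simp]: "lift c x \<in> Z3_vecs {0..n}"
  by (auto simp: Z3_vecs_def lift_def PiE_iff extensional_def)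

lemma lift_apply [simp]: "lift c x i = (if i = 0 then c else if i \<le> n then x i else undefined)"
  by (auto simp: lift_def)

lemma lift_in_U: "lift c x \<in> U \<longleftrightarrow> c \<in> g x"
proof
  assume "lift c x \<in> U"
  then obtain y d where y: "y \<in> Z3_vecs {1..n}" "d \<in> Uf y" "lift c x = y(0 := d)"
    by (auto simp: corresponding_set_def fibred_def)
  have "y i = restrict x {1..n} i" if "i \<in> {1..n}" for i
    using fun_cong[OF y(3), of i] that by (simp add: lift_def)
  then have "y = restrict x {1..n}"
    using y(1) by (intro PiE_ext[of y "{1..n}" "\<lambda>_. UNIV"]) (auto simp: Z3_vecs_def)
  moreover have "c = d" using fun_cong[OF y(3), of 0] by simp
  ultimately show "c \<in> g x" using y(2) by (simp add: g_def)
next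
  assume "c \<in> g x"
  then show "lift c x \<in> U"
    by (auto simp: corresponding_set_def fibred_def g_def lift_def intro!: bexI[of _ "restrict x {1..n}"])
qed

lemma U_subset: "U \<subseteq> Z3_vecs {0..n}"
  by (auto simp: corresponding_set_def fibred_def Z3_vecs_def PiE_iff extensional_def)

lemma U_unique_neighbour:
  "\<lbrakk>v \<in> U; w \<in> U; w' \<in> U; hamming_adj {0..n} v w; hamming_adj {0..n} v w'\<rbrakk> \<Longrightarrow> w = w'"
  using induced_max_degree_le1D[of U "hamming_adj {0..n}" v w w'] degree1
    finite_subset[OF U_subset finite_Z3_vecs] by (simp add: has_induced_degree_1_def)

lemma lift_adj_vertical: "c \<noteq> d \<Longrightarrow> hamming_adj {0..n} (lift c x) (lift d x)"
  by (rule hamming_adjI[of _ _ _ 0]) simp_all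

lemma lift_adj_horizontal:
  "\<lbrakk>i \<in> {1..n}; a \<noteq> x i\<rbrakk> \<Longrightarrow> hamming_adj {0..n} (lift c x) (lift c (x(i := a)))"
  by (rule hamming_adjI[of _ _ _ i]) simp_all

sublocale degree1_section "{1..n}" g
proof
  show "g x \<noteq> {}" for x
    using funcset_mem[OF in_range, of "restrict x {1..n}"]
    by (auto simp: g_def val_A_def val_B_def val_C_def val_X_def val_Y_def val_Z_def)
  show "c \<notin> g (x(i := a))" if "c \<in> g x" "d \<in> g x" "c \<noteq> d" "i \<in> {1..n}" "a \<noteq> x i" for c x d i a
  proof
    assume "c \<in> g (x(i := a))"
    then have "lift d x = lift c (x(i := a))"
      using that lift_adj_vertical[of c d x] lift_adj_horizontal[of i a x c]
      by (intro U_unique_neighbour[of "lift c x"]) (simp_all add: lift_in_U)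
    from fun_cong[OF this, of 0] show False using that by simp
  qed
  show "d = e" if "c \<in> g x" "d \<in> g x" "e \<in> g x" "c \<noteq> d" "c \<noteq> e" for c d e x
  proof -
    have "lift d x = lift e x"
      using that lift_adj_vertical[of c d x] lift_adj_vertical[of c e x]
      by (intro U_unique_neighbour[of "lift c x"]) (simp_all add: lift_in_U)
    from fun_cong[OF this, of 0] show ?thesis by simp
  qed
  show "x(i := a) = x(j := b)"
    if "c \<in> g x" "c \<in> g (x(i := a))" "c \<in> g (x(j := b))" "i \<in> {1..n}" "j \<in> {1..n}" "a \<noteq> x i" "b \<noteq> x j"
    for c x i a j b
  proof -
    have "lift c (x(i := a)) = lift c (x(j := b))"
      using that lift_adj_horizontal[of i a x c] lift_adj_horizontal[of j b x c]
      by (intro U_unique_neighbour[of "lift c x"]) (simp_all add: lift_in_U)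
    from fun_cong[OF this, of i] have "i = j \<and> a = b"
      using that by (auto split: if_splits)
    then show ?thesis by simp
  qed
  have "restrict (\<lambda>_. 0) {1..n} = zero_vec n" by (simp add: zero_vec_def)
  then show "g (\<lambda>_. 0) = {1, 2}" using zero by (simp add: g_def val_X_def)
qed

definition extend :: "nat set \<Rightarrow> (nat \<Rightarrow> 3) \<Rightarrow> nat \<Rightarrow> 3" where
  "extend I z = (\<lambda>i. if i \<in> I then z i else 0)"

lemma restricted_set_eq:
  assumes I: "I \<subseteq> {1..n}"
  shows "(\<lambda>u. restrict u (insert 0 I)) ` (U \<inter> fibred (coord_subcube n I) (\<lambda>_. UNIV)) =
    {z \<in> Z3_vecs (insert 0 I). z 0 \<in> g (extend I z)}" (is "?L = ?R")
proof
  show "?L \<subseteq> ?R"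
  proof
    fix z assume "z \<in> ?L"
    then obtain x c where x: "x \<in> coord_subcube n I" "x(0 := c) \<in> U" "z = restrict (x(0 := c)) (insert 0 I)"
      by (auto simp: fibred_def)
    have "restrict (extend I z) {1..n} = x"
    proof (rule PiE_ext[of _ "{1..n}" "\<lambda>_. UNIV"])
      show "x \<in> {1..n} \<rightarrow>\<^sub>E UNIV" using x(1) by (simp add: coord_subcube_def Z3_vecs_def)
    qed (use x(1,3) I in \<open>auto simp: extend_def coord_subcube_def\<close>)
    then have "lift c (extend I z) = x(0 := c)" by (simp add: lift_def)
    then have "c \<in> g (extend I z)" using x(2) lift_in_U by metis
    then show "z \<in> ?R" using x(3) by simp
  qed
  show "?R \<subseteq> ?L"
  proof
    fix z assume z: "z \<in> ?R"
    let ?u = "lift (z 0) (extend I z)"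
    have "?u \<in> U" using z lift_in_U by simp
    moreover have "restrict (extend I z) {1..n} \<in> coord_subcube n I"
      by (auto simp: coord_subcube_def extend_def)
    then have "?u \<in> fibred (coord_subcube n I) (\<lambda>_. UNIV)"
      unfolding fibred_def lift_def by blast
    moreover have "z = restrict ?u (insert 0 I)"
    proof (rule PiE_ext[of _ "insert 0 I" "\<lambda>_. UNIV"])
      show "z \<in> insert 0 I \<rightarrow>\<^sub>E UNIV" using z by (simp add: Z3_vecs_def)
    qed (use I in \<open>auto simp: extend_def\<close>)
    ultimately show "z \<in> ?L" by blast
  qed
qed

text \<open>Nonempty fibres and the second element over the origin give the size, the graph of the
  form is the disjoint independent set, and extension by zeros preserves adjacency.\<close>

lemma restriction_canonicalI:
  assumes I: "I \<subseteq> {1..n}" and w: "\<And>i. i \<in> I \<Longrightarrow> w i \<noteq> 0"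
    and avoid: "\<And>x. (\<And>i. i \<notin> I \<Longrightarrow> x i = 0) \<Longrightarrow> (\<Sum>i\<in>I. w i * x i) \<notin> g x"
  shows "restriction_canonical n Uf I"
proof -
  have fin: "finite I" and I0: "0 \<notin> I" using I finite_subset by auto
  let ?K = "insert 0 I"
  define V where "V = {z \<in> Z3_vecs ?K. z 0 \<in> g (extend I z)}"
  have finV: "finite V" using finite_Z3_vecs[of ?K] fin by (simp add: V_def)
  have update_V: "z(0 := c) \<in> V" if "z \<in> Z3_vecs I" "c \<in> g (extend I z)" for z c
  proof -
    have "extend I (z(0 := c)) = extend I z" using I0 by (auto simp: extend_def fun_eq_iff)
    then show ?thesis using that by (auto simp: V_def Z3_vecs_def PiE_iff extensional_def)
  qed
  have update_inj: "z = z'" if "z \<in> Z3_vecs I" "z' \<in> Z3_vecs I" "z(0 := c) = z'(0 := c')" for z z' c c'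
  proof (rule PiE_ext[of _ I "\<lambda>_. UNIV"])
    fix i assume "i \<in> I"
    then show "z i = z' i" using fun_cong[OF that(3), of i] I0 by (auto split: if_splits)
  qed (use that in \<open>auto simp: Z3_vecs_def\<close>)
  have card_V: "card V \<ge> 3 ^ card I + 1"
  proof -
    \<comment> \<open>One element of each fibre; \<open>d\<close> below is the other element over
      the origin, which accounts for the summand 1.\<close>
    define c where "c z = (SOME c. c \<in> g (extend I z))" for z
    have c: "c z \<in> g (extend I z)" for z
      unfolding c_def using nonempty[of "extend I z"] by (simp add: some_in_eq)
    define p0 :: "nat \<Rightarrow> 3" where "p0 = restrict (\<lambda>_. 0) I"
    have "extend I p0 = (\<lambda>_. 0)" by (auto simp: extend_def p0_def)
    then have "g (extend I p0) = {1, 2}" by (simp only: origin)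
    then have "(if c p0 = 1 then 2 else 1) \<in> g (extend I p0)" by simp
    moreover have "(if c p0 = 1 then 2 else 1) \<noteq> c p0" by simp
    ultimately obtain d where d: "d \<in> g (extend I p0)" "d \<noteq> c p0" by blast
    let ?W = "(\<lambda>z. z(0 := c z)) ` Z3_vecs I"
    have "card ?W = 3 ^ card I"
    proof (subst card_image)
      show "inj_on (\<lambda>z. z(0 := c z)) (Z3_vecs I)" by (rule inj_onI) (rule update_inj)
    qed (rule card_Z3_vecs[OF fin])
    moreover have "p0(0 := d) \<notin> ?W"
    proof
      assume "p0(0 := d) \<in> ?W"
      then obtain z where z: "z \<in> Z3_vecs I" "p0(0 := d) = z(0 := c z)" by blast
      have "p0 = z" using update_inj[OF _ z] by (simp add: p0_def)
      then show False using fun_cong[OF z(2), of 0] d(2) by simp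
    qed
    moreover have "insert (p0(0 := d)) ?W \<subseteq> V"
      using update_V c d(1) by (auto simp: p0_def)
    moreover have "finite ?W" using finite_Z3_vecs[OF fin] by simp
    ultimately show ?thesis
      using card_mono[OF finV, of "insert (p0(0 := d)) ?W"] by simp
  qed
  have card_K: "card ?K - 1 = card I" using fin I0 by simp
  have disjoint: "V \<inter> {z \<in> Z3_vecs ?K. z 0 = (\<Sum>i\<in>I. w i * z i)} = {}"
  proof -
    have "(\<Sum>i\<in>I. w i * z i) = (\<Sum>i\<in>I. w i * extend I z i)" for z
      by (intro sum.cong) (simp_all add: extend_def)
    then show ?thesis using avoid[of "extend I z" for z] by (auto simp: V_def extend_def)
  qed
  have degree: "induced_max_degree (hamming_adj ?K) V \<le> 1"
  proof (rule induced_max_degree_le1I[OF finV])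
    show "V \<noteq> {}" using card_V by auto
  next
    fix v w w' assume V: "v \<in> V" "w \<in> V" "w' \<in> V"
      and adj: "hamming_adj ?K v w" "hamming_adj ?K v w'"
    \<comment> \<open>Points of the restriction return to \<open>U\<close> with zeros in the deleted
      coordinates, where neighbours are unique.\<close>
    let ?l = "\<lambda>z. lift (z 0) (extend I z)"
    have l: "?l z i = (if i \<in> ?K then z i else 0)" if "i \<in> {0..n}" for z i
      using that I0 by (cases "i = 0") (auto simp: extend_def)
    have adj_l: "hamming_adj {0..n} (?l y) (?l z)" if "hamming_adj ?K y z" for y z
    proof -
      obtain i where i: "i \<in> ?K" "y i \<noteq> z i" "\<And>j. \<lbrakk>j \<in> ?K; j \<noteq> i\<rbrakk> \<Longrightarrow> y j = z j"
        using \<open>hamming_adj ?K y z\<close> by (rule hamming_adjE) blast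
      have "i \<in> {0..n}" using i(1) I by auto
      then show ?thesis
        using i by (intro hamming_adjI[of _ _ _ i]) (simp_all add: l del: lift_apply)
    qed
    have "?l w = ?l w'"
      using V adj[THEN adj_l] by (intro U_unique_neighbour[of "?l v"]) (simp_all add: V_def lift_in_U)
    from fun_cong[OF this] have "w i = w' i" if "i \<in> ?K" for i
      using l[of i w] l[of i w'] that I by (auto simp del: lift_apply)
    then show "w = w'"
      using V by (intro PiE_ext[of w ?K "\<lambda>_. UNIV"]) (auto simp: V_def Z3_vecs_def)
  qed
  have "canonical ?K V"
    unfolding canonical_def
  proof (intro conjI exI)
    show "V \<subseteq> Z3_vecs ?K" by (auto simp: V_def)
    show "card V \<ge> 3 ^ (card ?K - 1) + 1" unfolding card_K by (fact card_V)
    show "hamming_max_independent ?K {z \<in> Z3_vecs ?K. z 0 = (\<Sum>i\<in>I. w i * z i)}"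
      using fin I0 w by (rule affine_max_independent)
  qed (fact disjoint degree)+
  then show ?thesis
    unfolding restriction_canonical_def restricted_set_eq[OF I] V_def .
qed

end

theorem theorem5p12:
  fixes n :: nat and Uf :: "(nat \<Rightarrow> 3) \<Rightarrow> 3 set"
  assumes "n \<ge> 6"
    and "Uf \<in> Z3_vecs {1..n} \<rightarrow> {val_A, val_B, val_C, val_X, val_Y, val_Z}"
    and "has_induced_degree_1 n Uf"
    and "Uf (zero_vec n) = val_X"
  shows "\<exists>I \<subseteq> {1..n}. card I \<ge> n - 4 \<and> restriction_canonical n Uf I"
proof -
  interpret fibred_induced_degree1 n Uf
    using assms by unfold_locales
  obtain I w where I: "I \<subseteq> {1..n}" "card {1..n} \<le> card I + 4" "\<And>i. i \<in> I \<Longrightarrow> w i \<noteq> 0"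
    "\<And>x. (\<And>i. i \<notin> I \<Longrightarrow> x i = 0) \<Longrightarrow> (\<Sum>i\<in>I. w i * x i) \<notin> g x"
    using exists_avoiding_linear_form by blast
  have "restriction_canonical n Uf I"
    using I(1,3,4) by (rule restriction_canonicalI)
  moreover have "card I \<ge> n - 4" using I(2) by simp
  ultimately show ?thesis using I(1) by blast
qed

end
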